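(* Let $f$ be a step function whose search hits at every $n\in\mathbb N$, let $G=\mathcal A\cdot\mathrm{rrep}(f)$, and suppose $\emptyset\vdash G$ is not derivable in OGA. Then all of the following hold: (i) $\emptyset\vdash G\,\mathsf B$ is derivable in OGA; (ii) $\emptyset\vdash\neg G$ is not derivable in OGA; (iii) $\emptyset\vdash G$ is not derivable in OGA; (iv) $G$ is a genuine fiction; (v) the extension of OGA by $G$ proves no contradiction, i.e. there is no term $c$ with both $\{G\}\vdash c$ and $\{G\}\vdash\neg c$ derivable in OGA.
   Context: **Syntax.** Terms: $t::=v_i\mid\bot\mid\mathbf 0\mid\mathbf S t\mid t=t\mid\neg t\mid t\lor t\mid\lambda t\mid t\cdot t\mid\mathcal R\mid\mathcal A$ ($v_i$, $i\in\mathbb N$, de Bruijn variables; $\lambda$ is the only binder; application associates to the left). A term is well-formed (wf) if generated by this grammar. $\bot$ is a divergent constant, $\mathcal R$ the primitive recursor, $\mathcal A$ the universal quantifier. Abbreviations: $t\,\mathsf N$ is $t=t$; $t\,\mathsf B$ is $t\lor\neg t$; $t\ne u$ is $\neg(t=u)$; $t\land u$ is $\neg(\neg t\lor\neg u)$; $t\to u$ is $\neg t\lor u$; $\underline n=\mathbf S^n\mathbf 0$. $\uparrow$ shifts all free indices up by one; $b[t]$ is the $\beta$-instance substituting $t$ for the outermost bound variable of $b$; $[v\mapsto s]$ is capture-avoiding substitution for a free variable; $\mathrm{fv}$ is the set of free variables. **Head steps** $\triangleright$: $(\lambda b)\cdot t\triangleright b[t]$; $\mathcal R\cdot g\cdot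 h\cdot\mathbf 0\triangleright g$; $\mathcal R\cdot g\cdot h\cdot(\mathbf S\underline n)\triangleright h\cdot\underline n\cdot(\mathcal R\cdot g\cdot h\cdot\underline n)$; if $t\triangleright t'$ then $t\cdot u\triangleright t'\cdot u$. **Rules.** Judgments are $\Gamma\vdash c$, $\Gamma$ a finite set of wf terms, $c$ a wf term (all terms in rules are wf). A proof is a finite list of judgments each following from earlier entries by one rule; $\Gamma\vdash c$ is derivable if it occurs in a proof. Rules ("$\Rightarrow$" from premises to conclusion, "$\Leftrightarrow$" both directions; $\Gamma$ is the context of a judgment when none is shown): $\Gamma,c\vdash c$; $\Gamma\vdash c\Rightarrow\Gamma,a\vdash c$; $\Gamma\vdash a$ and $\Gamma,a\vdash c\Rightarrow\Gamma\vdash c$; $\Gamma\vdash c\Rightarrow[v\mapsto s]\Gamma\vdash[v\mapsto s]c$; $\vdash a\Leftrightarrow\ \vdash a=\underline1$; $\vdash\neg a\Leftrightarrow\ \vdash a=\underline0$; $\vdash\neg a,\ \vdash a\Rightarrow\ \vdash c$; $\vdash a\Leftrightarrow\ \vdash\neg\neg a$; $\vdash a\Rightarrow\ \vdash a\lor b$; $\vdash b\Rightarrow\ \vdash a\lor b$; $\vdash\neg a,\ \vdash\neg b\Rightarrow\ \vdash\neg(a\lor b)$; $\vdash a\lor b,\ \Gamma,a\vdash c,\ \Gamma,b\vdash c\Rightarrow\ \vdash c$; $\vdash\neg(a\lor b)\Rightarrow\ \vdash\neg a$; $\vdash\neg(a\lor b)\Rightarrow\ \vdash\neg b$; $\vdash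 a\,\mathsf N\Leftrightarrow\ \vdash a=a$; $\vdash a=b\Rightarrow\ \vdash b=a$; $\vdash a=b,\ \vdash[v\mapsto a]p\Rightarrow\ \vdash[v\mapsto b]p$; $\vdash a\ne b\Rightarrow\ \vdash b\ne a$; $\vdash a\,\mathsf N,\ \vdash b\,\mathsf N\Rightarrow\ \vdash(a=b)\,\mathsf B$; $\vdash(a=b)\,\mathsf B\Rightarrow\ \vdash(a\,\mathsf N)\land(b\,\mathsf N)$; $\vdash\mathbf 0\,\mathsf N$; $\vdash a\,\mathsf N\Leftrightarrow\ \vdash(\mathbf S a)\,\mathsf N$; $\vdash a\,\mathsf N\Rightarrow\ \vdash\mathbf S a\ne\mathbf 0$; $\vdash a\ne b\Leftrightarrow\ \vdash\mathbf S a\ne\mathbf S b$; $\vdash\mathbf S a=\mathbf S b\Rightarrow\ \vdash a=b$; $\vdash\bot\,\mathsf N\Rightarrow\ \vdash p$; induction: $\vdash[v_i\mapsto\mathbf 0]c$, $\ v_i\,\mathsf N,c,\Gamma\vdash[v_i\mapsto\mathbf S v_i]c$, $\ \vdash a\,\mathsf N\Rightarrow\ \vdash[v_i\mapsto a]c$ if $v_i\notin\mathrm{fv}(\Gamma)$; conversion, for $c\triangleright c'$: $\vdash c'\Rightarrow\ \vdash c$; $\vdash c\Rightarrow\ \vdash c'$; $\vdash\neg c\Rightarrow\ \vdash\neg c'$; $\vdash c'\,\mathsf N\Rightarrow\ \vdash c=c'$; $\vdash m\,\mathsf N,\ \vdash(h\cdot m\cdot(\mathcal R\cdot g\cdot h\cdot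 m))\,\mathsf N\Rightarrow\ \vdash\mathcal R\cdot g\cdot h\cdot(\mathbf S m)=h\cdot m\cdot(\mathcal R\cdot g\cdot h\cdot m)$; $v_0\,\mathsf N,\uparrow\Gamma\vdash\uparrow f\cdot v_0\Rightarrow\Gamma\vdash\mathcal A\cdot f$; $\vdash\mathcal A\cdot f,\ \vdash a\,\mathsf N\Rightarrow\ \vdash f\cdot a$; $\vdash\neg(f\cdot a),\ \vdash a\,\mathsf N\Rightarrow\ \vdash\neg(\mathcal A\cdot f)$; $\Gamma\vdash\neg(\mathcal A\cdot f)$ and $v_0\,\mathsf N,\neg(\uparrow f\cdot v_0),\uparrow\Gamma\vdash\uparrow c\Rightarrow\Gamma\vdash c$. These are the rules of RGA. OGA has these and the rule ATI: $\Gamma\vdash\mathcal A\cdot(\lambda((\uparrow u\cdot v_0)\,\mathsf B))\Rightarrow\Gamma\vdash(\mathcal A\cdot u)\,\mathsf B$. Below $\vdash$ is OGA-derivability. **Search sentences.** A step function is a primitive recursive $f:\mathbb N^2\to\mathbb N$ presented by a primitive recursive definition (from zero, successor, projections by composition and primitive recursion); different definitions of the same function count as different step functions. Its search at $n$ hits at step $k$ if $f(n,k)\neq0$, and hits if it hits at some step. $\mathrm{cmp}(f)$ is the closed term obtained by compiling the definition into curried $\lambda$-terms: zero functions to $\lambda\cdots\lambda\,\mathbf 0$, successor to $\lambda\,\mathbf S v_0$, projections to $\lambda\cdots\lambda\,v_i$, composition to the corresponding applications, and $F(0,\vec x)=G(\vec x)$, $F(m+1,\vec x)=H(m,F(m,\vec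 x),\vec x)$ to the curried term sending $y,\vec x$ to $\mathcal R\cdot(\mathrm{cmp}(G)\cdot\vec x)\cdot(\lambda\lambda\,\mathrm{cmp}(H)\cdot v_1\cdot v_0\cdot\vec x)\cdot y$ (indices of $\vec x$ shifted under the $\lambda$s). Put $\mathrm{rrep}(f)=\lambda\,\neg(\mathcal A\cdot\lambda(\mathrm{cmp}(f)\cdot v_1\cdot v_0=\mathbf 0))$. $\mathrm{rrep}(f)\cdot\underline n$ expresses that the search of $f$ at $n$ hits, and $\mathcal A\cdot\mathrm{rrep}(f)$ that it hits at every $n$. **Fafi values and fictions.** A universal $\mathcal A\cdot u$ is certified if $\emptyset\vdash\mathcal A\cdot(\lambda((\uparrow u\cdot v_0)\,\mathsf B))$. For each certified $\mathcal A\cdot u$ there is an atom $x_{\mathcal A\cdot u}$. Values are elements of the free Boolean algebra on these atoms, with constants $\top$ and $\mathsf F$. Evaluation $\varphi\rightsquigarrow p$ ("$p$ is a value of $\varphi$") is the least relation with: $\varphi\rightsquigarrow\top$ if $\emptyset\vdash\varphi$; $\varphi\rightsquigarrow\mathsf F$ if $\emptyset\vdash\neg\varphi$; $\varphi\rightsquigarrow p$ implies $\neg\varphi\rightsquigarrow\neg p$; $\varphi\rightsquigarrow p$, $\psi\rightsquigarrow q$ imply $\varphi\lor\psi\rightsquigarrow p\lor q$; $\mathcal A\cdot u\rightsquigarrow x_{\mathcal A\cdot u}$ if $\mathcal A\cdot u$ is certified. A sentence $\varphi$ is a genuine fiction if it has a value and neither $\emptyset\vdash\varphi$ nor $\emptyset\vdash\neg\varphi$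 is derivable in OGA. *)

theory Defs
  imports Main "HOL-Library.FSet"
begin

section \<open>Terms\<close>

text \<open>Every element of this type is a well-formed term.\<close>

datatype tm =
    Var nat
  | Bot
  | Zero
  | S tm
  | Eq tm tm  (infix "\<doteq>" 55)
  | Neg tm
  | Or tm tm  (infixr "\<squnion>" 50)
  | Lam tm
  | App tm tm  (infixl "\<cdot>" 70)
  | Rec
  | All

abbreviation is_N :: "tm \<Rightarrow> tm" where "is_N t \<equiv> t \<doteq> t"
abbreviation is_B :: "tm \<Rightarrow> tm" where "is_B t \<equiv> t \<squnion> Neg t"
abbreviation Neq :: "tm \<Rightarrow> tm \<Rightarrow> tm" where "Neq t u \<equiv> Neg (t \<doteq> u)"
abbreviation And :: "tm \<Rightarrow> tm \<Rightarrow> tm" where "And t u \<equiv> Neg (Neg t \<squnion> Neg u)"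

definition numeral_tm :: "nat \<Rightarrow> tm" where
  "numeral_tm n = (S ^^ n) Zero"

text \<open>\<open>lift_from k\<close> shifts the indices \<open>\<ge> k\<close>, i.e. those free below \<open>k\<close> binders.\<close>

primrec lift_from :: "nat \<Rightarrow> tm \<Rightarrow> tm" where
  "lift_from k (Var i) = Var (if i < k then i else Suc i)"
| "lift_from k Bot = Bot"
| "lift_from k Zero = Zero"
| "lift_from k (S t) = S (lift_from k t)"
| "lift_from k (t \<doteq> u) = (lift_from k t \<doteq> lift_from k u)"
| "lift_from k (Neg t) = Neg (lift_from k t)"
| "lift_from k (t \<squnion> u) = (lift_from k t \<squnion> lift_from k u)"
| "lift_from k (Lam t) = Lam (lift_from (Suc k) t)"
| "lift_from k (t \<cdot> u) = lift_from k t \<cdot> lift_from k u"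
| "lift_from k Rec = Rec"
| "lift_from k All = All"

abbreviation up :: "tm \<Rightarrow> tm" where "up \<equiv> lift_from 0"

text \<open>\<open>subst i s t\<close> is \<open>[v\<^sub>i \<mapsto> s] t\<close>; all other free variables keep their index.\<close>

primrec subst :: "nat \<Rightarrow> tm \<Rightarrow> tm \<Rightarrow> tm" where
  "subst i s (Var j) = (if j = i then s else Var j)"
| "subst i s Bot = Bot"
| "subst i s Zero = Zero"
| "subst i s (S t) = S (subst i s t)"
| "subst i s (t \<doteq> u) = (subst i s t \<doteq> subst i s u)"
| "subst i s (Neg t) = Neg (subst i s t)"
| "subst i s (t \<squnion> u) = (subst i s t \<squnion> subst i s u)"
| "subst i s (Lam t) = Lam (subst (Suc i) (up s) t)"
| "subst i s (t \<cdot> u) = subst i s t \<cdot> subst i s u"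
| "subst i s Rec = Rec"
| "subst i s All = All"

text \<open>\<open>inst k s b\<close> replaces index \<open>k\<close> by \<open>s\<close> and lowers the indices above \<open>k\<close>, whose
  binder has disappeared; the \<open>\<beta>\<close>-instance \<open>b[s]\<close> is \<open>inst 0 s b\<close>.\<close>

primrec inst :: "nat \<Rightarrow> tm \<Rightarrow> tm \<Rightarrow> tm" where
  "inst k s (Var j) = (if j < k then Var j else if j = k then s else Var (j - 1))"
| "inst k s Bot = Bot"
| "inst k s Zero = Zero"
| "inst k s (S t) = S (inst k s t)"
| "inst k s (t \<doteq> u) = (inst k s t \<doteq> inst k s u)"
| "inst k s (Neg t) = Neg (inst k s t)"
| "inst k s (t \<squnion> u) = (inst k s t \<squnion> inst k s u)"
| "inst k s (Lam t) = Lam (inst (Suc k) (up s) t)"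
| "inst k s (t \<cdot> u) = inst k s t \<cdot> inst k s u"
| "inst k s Rec = Rec"
| "inst k s All = All"

primrec fv :: "tm \<Rightarrow> nat set" where
  "fv (Var i) = {i}"
| "fv Bot = {}"
| "fv Zero = {}"
| "fv (S t) = fv t"
| "fv (t \<doteq> u) = fv t \<union> fv u"
| "fv (Neg t) = fv t"
| "fv (t \<squnion> u) = fv t \<union> fv u"
| "fv (Lam t) = {i. Suc i \<in> fv t}"
| "fv (t \<cdot> u) = fv t \<union> fv u"
| "fv Rec = {}"
| "fv All = {}"


section \<open>Head steps\<close>

inductive head_step :: "tm \<Rightarrow> tm \<Rightarrow> bool"  (infix "\<rhd>" 45) where
  beta: "Lam b \<cdot> t \<rhd> inst 0 t b"
| rec_zero: "Rec \<cdot> g \<cdot> h \<cdot> Zero \<rhd> g"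
| rec_succ: "Rec \<cdot> g \<cdot> h \<cdot> S (numeral_tm n) \<rhd> h \<cdot> numeral_tm n \<cdot> (Rec \<cdot> g \<cdot> h \<cdot> numeral_tm n)"
| app: "t \<rhd> t' \<Longrightarrow> t \<cdot> u \<rhd> t' \<cdot> u"


section \<open>Rules and derivability\<close>

type_synonym sequent = "tm fset \<times> tm"

text \<open>\<open>rga_rule J j\<close>: the sequent \<open>j\<close> follows from sequents in \<open>J\<close> by one rule of RGA.
  Since \<open>is_N a\<close> is \<open>a \<doteq> a\<close>, both directions of the rule relating them are \<open>eqN\<close>.\<close>

inductive rga_rule :: "sequent set \<Rightarrow> sequent \<Rightarrow> bool" for J where
  hyp: "rga_rule J (finsert c \<Gamma>, c)"
| weak: "(\<Gamma>, c) \<in> J \<Longrightarrow> rga_rule J (finsert a \<Gamma>, c)"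
| cut: "(\<Gamma>, a) \<in> J \<Longrightarrow> (finsert a \<Gamma>, c) \<in> J \<Longrightarrow> rga_rule J (\<Gamma>, c)"
| subst: "(\<Gamma>, c) \<in> J \<Longrightarrow> rga_rule J (subst i s |`| \<Gamma>, subst i s c)"

| eq1I: "(\<Gamma>, a) \<in> J \<Longrightarrow> rga_rule J (\<Gamma>, a \<doteq> numeral_tm 1)"
| eq1E: "(\<Gamma>, a \<doteq> numeral_tm 1) \<in> J \<Longrightarrow> rga_rule J (\<Gamma>, a)"
| eq0I: "(\<Gamma>, Neg a) \<in> J \<Longrightarrow> rga_rule J (\<Gamma>, a \<doteq> numeral_tm 0)"
| eq0E: "(\<Gamma>, a \<doteq> numeral_tm 0) \<in> J \<Longrightarrow> rga_rule J (\<Gamma>, Neg a)"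

| contra: "(\<Gamma>, Neg a) \<in> J \<Longrightarrow> (\<Gamma>, a) \<in> J \<Longrightarrow> rga_rule J (\<Gamma>, c)"
| notnotI: "(\<Gamma>, a) \<in> J \<Longrightarrow> rga_rule J (\<Gamma>, Neg (Neg a))"
| notnotE: "(\<Gamma>, Neg (Neg a)) \<in> J \<Longrightarrow> rga_rule J (\<Gamma>, a)"

| orI1: "(\<Gamma>, a) \<in> J \<Longrightarrow> rga_rule J (\<Gamma>, a \<squnion> b)"
| orI2: "(\<Gamma>, b) \<in> J \<Longrightarrow> rga_rule J (\<Gamma>, a \<squnion> b)"
| norI: "(\<Gamma>, Neg a) \<in> J \<Longrightarrow> (\<Gamma>, Neg b) \<in> J \<Longrightarrow> rga_rule J (\<Gamma>, Neg (a \<squnion> b))"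
| orE: "(\<Gamma>, a \<squnion> b) \<in> J \<Longrightarrow> (finsert a \<Gamma>, c) \<in> J \<Longrightarrow> (finsert b \<Gamma>, c) \<in> J
    \<Longrightarrow> rga_rule J (\<Gamma>, c)"
| norE1: "(\<Gamma>, Neg (a \<squnion> b)) \<in> J \<Longrightarrow> rga_rule J (\<Gamma>, Neg a)"
| norE2: "(\<Gamma>, Neg (a \<squnion> b)) \<in> J \<Longrightarrow> rga_rule J (\<Gamma>, Neg b)"

| eqN: "(\<Gamma>, is_N a) \<in> J \<Longrightarrow> rga_rule J (\<Gamma>, a \<doteq> a)"
| eq_sym: "(\<Gamma>, a \<doteq> b) \<in> J \<Longrightarrow> rga_rule J (\<Gamma>, b \<doteq> a)"
| eq_subst: "(\<Gamma>, a \<doteq> b) \<in> J \<Longrightarrow> (\<Gamma>, subst i a p) \<in> J \<Longrightarrow> rga_rule J (\<Gamma>, subst i b p)"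
| neq_sym: "(\<Gamma>, Neq a b) \<in> J \<Longrightarrow> rga_rule J (\<Gamma>, Neq b a)"
| eqB_I: "(\<Gamma>, is_N a) \<in> J \<Longrightarrow> (\<Gamma>, is_N b) \<in> J \<Longrightarrow> rga_rule J (\<Gamma>, is_B (a \<doteq> b))"
| eqB_E: "(\<Gamma>, is_B (a \<doteq> b)) \<in> J \<Longrightarrow> rga_rule J (\<Gamma>, And (is_N a) (is_N b))"

| zeroN: "rga_rule J (\<Gamma>, is_N Zero)"
| succN_I: "(\<Gamma>, is_N a) \<in> J \<Longrightarrow> rga_rule J (\<Gamma>, is_N (S a))"
| succN_E: "(\<Gamma>, is_N (S a)) \<in> J \<Longrightarrow> rga_rule J (\<Gamma>, is_N a)"
| succ_neq_zero: "(\<Gamma>, is_N a) \<in> J \<Longrightarrow> rga_rule J (\<Gamma>, Neq (S a) Zero)"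
| succ_neqI: "(\<Gamma>, Neq a b) \<in> J \<Longrightarrow> rga_rule J (\<Gamma>, Neq (S a) (S b))"
| succ_neqE: "(\<Gamma>, Neq (S a) (S b)) \<in> J \<Longrightarrow> rga_rule J (\<Gamma>, Neq a b)"
| succ_inj: "(\<Gamma>, S a \<doteq> S b) \<in> J \<Longrightarrow> rga_rule J (\<Gamma>, a \<doteq> b)"
| botN: "(\<Gamma>, is_N Bot) \<in> J \<Longrightarrow> rga_rule J (\<Gamma>, p)"

| nat_ind: "(\<Gamma>, subst i Zero c) \<in> J
    \<Longrightarrow> (finsert (is_N (Var i)) (finsert c \<Gamma>), subst i (S (Var i)) c) \<in> J
    \<Longrightarrow> (\<Gamma>, is_N a) \<in> J
    \<Longrightarrow> \<forall>g \<in> fset \<Gamma>. i \<notin> fv g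
    \<Longrightarrow> rga_rule J (\<Gamma>, subst i a c)"

| conv_expand: "c \<rhd> c' \<Longrightarrow> (\<Gamma>, c') \<in> J \<Longrightarrow> rga_rule J (\<Gamma>, c)"
| conv_reduce: "c \<rhd> c' \<Longrightarrow> (\<Gamma>, c) \<in> J \<Longrightarrow> rga_rule J (\<Gamma>, c')"
| conv_neg: "c \<rhd> c' \<Longrightarrow> (\<Gamma>, Neg c) \<in> J \<Longrightarrow> rga_rule J (\<Gamma>, Neg c')"
| conv_eq: "c \<rhd> c' \<Longrightarrow> (\<Gamma>, is_N c') \<in> J \<Longrightarrow> rga_rule J (\<Gamma>, c \<doteq> c')"
| rec_eq: "(\<Gamma>, is_N m) \<in> J \<Longrightarrow> (\<Gamma>, is_N (h \<cdot> m \<cdot> (Rec \<cdot> g \<cdot> h \<cdot> m))) \<in> J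
    \<Longrightarrow> rga_rule J (\<Gamma>, Rec \<cdot> g \<cdot> h \<cdot> S m \<doteq> h \<cdot> m \<cdot> (Rec \<cdot> g \<cdot> h \<cdot> m))"

| allI: "(finsert (is_N (Var 0)) (up |`| \<Gamma>), up f \<cdot> Var 0) \<in> J \<Longrightarrow> rga_rule J (\<Gamma>, All \<cdot> f)"
| allE: "(\<Gamma>, All \<cdot> f) \<in> J \<Longrightarrow> (\<Gamma>, is_N a) \<in> J \<Longrightarrow> rga_rule J (\<Gamma>, f \<cdot> a)"
| nallI: "(\<Gamma>, Neg (f \<cdot> a)) \<in> J \<Longrightarrow> (\<Gamma>, is_N a) \<in> J \<Longrightarrow> rga_rule J (\<Gamma>, Neg (All \<cdot> f))"
| nallE: "(\<Gamma>, Neg (All \<cdot> f)) \<in> J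
    \<Longrightarrow> (finsert (is_N (Var 0)) (finsert (Neg (up f \<cdot> Var 0)) (up |`| \<Gamma>)), up c) \<in> J
    \<Longrightarrow> rga_rule J (\<Gamma>, c)"

inductive oga_rule :: "sequent set \<Rightarrow> sequent \<Rightarrow> bool" for J where
  rga: "rga_rule J j \<Longrightarrow> oga_rule J j"
| ATI: "(\<Gamma>, All \<cdot> Lam (is_B (up u \<cdot> Var 0))) \<in> J \<Longrightarrow> oga_rule J (\<Gamma>, is_B (All \<cdot> u))"

definition is_proof :: "(sequent set \<Rightarrow> sequent \<Rightarrow> bool) \<Rightarrow> sequent list \<Rightarrow> bool" where
  "is_proof R js \<longleftrightarrow> (\<forall>i < length js. R (set (take i js)) (js ! i))"

definition oga :: "tm fset \<Rightarrow> tm \<Rightarrow> bool"  (infix "\<turnstile>" 40) where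
  "\<Gamma> \<turnstile> c \<longleftrightarrow> (\<exists>js. is_proof oga_rule js \<and> (\<Gamma>, c) \<in> set js)"


section \<open>Primitive recursive definitions and search sentences\<close>

text \<open>\<open>PProj n i\<close> selects the argument at position \<open>i\<close>, counted from \<open>0\<close>, out of \<open>n\<close>.
  The number in \<open>PComp n F Gs\<close> is the common arity of the \<open>Gs\<close>, which is needed when
  that list is empty. \<open>PRec G H\<close> recurses on its first argument.\<close>

datatype primdef =
    PZero nat
  | PSucc
  | PProj nat nat
  | PComp nat primdef "primdef list"
  | PRec primdef primdef

fun arity :: "primdef \<Rightarrow> nat" where
  "arity (PZero n) = n"
| "arity PSucc = 1"
| "arity (PProj n i) = n"
| "arity (PComp n F Gs) = n"
| "arity (PRec G H) = Suc (arity G)"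

fun wf_primdef :: "primdef \<Rightarrow> bool" where
  "wf_primdef (PZero n) \<longleftrightarrow> True"
| "wf_primdef PSucc \<longleftrightarrow> True"
| "wf_primdef (PProj n i) \<longleftrightarrow> i < n"
| "wf_primdef (PComp n F Gs) \<longleftrightarrow>
     wf_primdef F \<and> arity F = length Gs \<and> (\<forall>G \<in> set Gs. wf_primdef G \<and> arity G = n)"
| "wf_primdef (PRec G H) \<longleftrightarrow> wf_primdef G \<and> wf_primdef H \<and> arity H = arity G + 2"

text \<open>The function defined; only meaningful on argument lists whose length is the arity.\<close>

fun peval :: "primdef \<Rightarrow> nat list \<Rightarrow> nat" where
  "peval (PZero n) xs = 0"
| "peval PSucc xs = Suc (hd xs)"
| "peval (PProj n i) xs = xs ! i"
| "peval (PComp n F Gs) xs = peval F (map (\<lambda>G. peval G xs) Gs)"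
| "peval (PRec G H) xs =
     rec_nat (peval G (tl xs)) (\<lambda>m r. peval H (m # r # tl xs)) (hd xs)"

text \<open>A step function is identified with its definition, so that different definitions of the
  same function are different step functions.\<close>

definition step_function :: "primdef \<Rightarrow> bool" where
  "step_function f \<longleftrightarrow> wf_primdef f \<and> arity f = 2"

definition hits_at_step :: "primdef \<Rightarrow> nat \<Rightarrow> nat \<Rightarrow> bool" where
  "hits_at_step f n k \<longleftrightarrow> peval f [n, k] \<noteq> 0"

definition hits :: "primdef \<Rightarrow> nat \<Rightarrow> bool" where
  "hits f n \<longleftrightarrow> (\<exists>k. hits_at_step f n k)"

definition lams :: "nat \<Rightarrow> tm \<Rightarrow> tm" where
  "lams n t = (Lam ^^ n) t"

definition apps :: "tm \<Rightarrow> tm list \<Rightarrow> tm" where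
  "apps t us = foldl App t us"

text \<open>The arguments of an \<open>n\<close>-ary curried term, first argument first, as seen directly below its
  \<open>n\<close> binders: \<open>v\<^bsub>n-1\<^esub>, \<dots>, v\<^sub>0\<close>.\<close>

definition args :: "nat \<Rightarrow> tm list" where
  "args n = map Var (rev [0..<n])"

text \<open>Compiled terms are closed and therefore need no shift when placed below binders.\<close>

fun cmp :: "primdef \<Rightarrow> tm" where
  "cmp (PZero n) = lams n Zero"
| "cmp PSucc = Lam (S (Var 0))"
| "cmp (PProj n i) = lams n (args n ! i)"
| "cmp (PComp n F Gs) = lams n (apps (cmp F) (map (\<lambda>G. apps (cmp G) (args n)) Gs))"
| "cmp (PRec G H) = (let xs = args (arity G) in
     lams (Suc (arity G))
       (Rec \<cdot> apps (cmp G) xs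
            \<cdot> Lam (Lam (apps (cmp H \<cdot> Var 1 \<cdot> Var 0) (map (\<lambda>x. up (up x)) xs)))
            \<cdot> Var (arity G)))"

definition rrep :: "primdef \<Rightarrow> tm" where
  "rrep f = Lam (Neg (All \<cdot> Lam (cmp f \<cdot> Var 1 \<cdot> Var 0 \<doteq> Zero)))"


section \<open>Free Boolean algebras\<close>

text \<open>The free Boolean algebra on \<open>'a\<close>: Boolean expressions over \<open>'a\<close> modulo the congruence
  generated by the axioms of Boolean algebras.\<close>

datatype 'a bexp =
    BAtom 'a
  | BTop
  | BBot
  | BNot "'a bexp"
  | BOr "'a bexp" "'a bexp"
  | BAnd "'a bexp" "'a bexp"

inductive beq :: "'a bexp \<Rightarrow> 'a bexp \<Rightarrow> bool" where
  beq_refl: "beq p p"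
| beq_sym: "beq p q \<Longrightarrow> beq q p"
| beq_trans: "beq p q \<Longrightarrow> beq q r \<Longrightarrow> beq p r"
| cong_not: "beq p p' \<Longrightarrow> beq (BNot p) (BNot p')"
| cong_or: "beq p p' \<Longrightarrow> beq q q' \<Longrightarrow> beq (BOr p q) (BOr p' q')"
| cong_and: "beq p p' \<Longrightarrow> beq q q' \<Longrightarrow> beq (BAnd p q) (BAnd p' q')"
| or_comm: "beq (BOr p q) (BOr q p)"
| and_comm: "beq (BAnd p q) (BAnd q p)"
| or_assoc: "beq (BOr (BOr p q) r) (BOr p (BOr q r))"
| and_assoc: "beq (BAnd (BAnd p q) r) (BAnd p (BAnd q r))"
| or_absorb: "beq (BOr p (BAnd p q)) p"
| and_absorb: "beq (BAnd p (BOr p q)) p"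
| or_distrib: "beq (BOr p (BAnd q r)) (BAnd (BOr p q) (BOr p r))"
| and_distrib: "beq (BAnd p (BOr q r)) (BOr (BAnd p q) (BAnd p r))"
| or_bot: "beq (BOr p BBot) p"
| and_top: "beq (BAnd p BTop) p"
| or_compl: "beq (BOr p (BNot p)) BTop"
| and_compl: "beq (BAnd p (BNot p)) BBot"

quotient_type 'a fba = "'a bexp" / beq
  by (intro equivpI reflpI sympI transpI) (blast intro: beq.intros)+

lift_definition fba_atom :: "'a \<Rightarrow> 'a fba" is BAtom .

instantiation fba :: (type) boolean_algebra
begin

lift_definition top_fba :: "'a fba" is BTop .
lift_definition bot_fba :: "'a fba" is BBot .
lift_definition uminus_fba :: "'a fba \<Rightarrow> 'a fba" is BNot by (rule cong_not)
lift_definition sup_fba :: "'a fba \<Rightarrow> 'a fba \<Rightarrow> 'a fba" is BOr by (rule cong_or)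
lift_definition inf_fba :: "'a fba \<Rightarrow> 'a fba \<Rightarrow> 'a fba" is BAnd by (rule cong_and)
definition minus_fba :: "'a fba \<Rightarrow> 'a fba \<Rightarrow> 'a fba" where "minus_fba p q = inf p (- q)"
definition less_eq_fba :: "'a fba \<Rightarrow> 'a fba \<Rightarrow> bool" where "less_eq_fba p q \<longleftrightarrow> inf p q = p"
definition less_fba :: "'a fba \<Rightarrow> 'a fba \<Rightarrow> bool" where "less_fba p q \<longleftrightarrow> p \<le> q \<and> \<not> q \<le> p"

instance
proof
  have sup_comm: "sup p q = sup q p" for p q :: "'a fba"
    by transfer (rule or_comm)
  have inf_comm: "inf p q = inf q p" for p q :: "'a fba"
    by transfer (rule and_comm)
  have sup_assoc: "sup (sup p q) r = sup p (sup q r)" for p q r :: "'a fba"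
    by transfer (rule or_assoc)
  have inf_assoc: "inf (inf p q) r = inf p (inf q r)" for p q r :: "'a fba"
    by transfer (rule and_assoc)
  have sup_absorb: "sup p (inf p q) = p" for p q :: "'a fba"
    by transfer (rule or_absorb)
  have inf_absorb: "inf p (sup p q) = p" for p q :: "'a fba"
    by transfer (rule and_absorb)
  have inf_idem: "inf p p = p" for p :: "'a fba"
    by (metis sup_absorb inf_absorb)
  have le_sup: "p \<le> q \<longleftrightarrow> sup p q = q" for p q :: "'a fba"
    unfolding less_eq_fba_def by (metis sup_absorb inf_absorb sup_comm inf_comm)
  fix x y z :: "'a fba"
  show "x < y \<longleftrightarrow> x \<le> y \<and> \<not> y \<le> x" by (rule less_fba_def)
  show "x \<le> x" by (simp add: less_eq_fba_def inf_idem)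
  show "x \<le> z" if "x \<le> y" "y \<le> z"
    using that unfolding less_eq_fba_def by (metis inf_assoc)
  show "x = y" if "x \<le> y" "y \<le> x"
    using that unfolding less_eq_fba_def by (metis inf_comm)
  show "inf x y \<le> x" unfolding less_eq_fba_def by (metis inf_assoc inf_comm inf_idem)
  show "inf x y \<le> y" unfolding less_eq_fba_def by (metis inf_assoc inf_idem)
  show "x \<le> inf y z" if "x \<le> y" "x \<le> z"
    using that unfolding less_eq_fba_def by (metis inf_assoc)
  show "x \<le> sup x y" unfolding less_eq_fba_def by (rule inf_absorb)
  show "y \<le> sup x y" unfolding less_eq_fba_def by (metis inf_absorb sup_comm)
  show "sup y z \<le> x" if "y \<le> x" "z \<le> x"
    using that unfolding le_sup by (metis sup_assoc)
  have "sup x bot = x" by transfer (rule or_bot)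
  then show "bot \<le> x" unfolding le_sup by (metis sup_comm)
  show "x \<le> top" unfolding less_eq_fba_def by transfer (rule and_top)
  show "sup x (inf y z) = inf (sup x y) (sup x z)" by transfer (rule or_distrib)
  show "inf x (- x) = bot" by transfer (rule and_compl)
  show "sup x (- x) = top" by transfer (rule or_compl)
  show "x - y = inf x (- y)" by (rule minus_fba_def)
qed

end


section \<open>Fafi values and genuine fictions\<close>

definition certified :: "tm \<Rightarrow> bool" where
  "certified \<phi> \<longleftrightarrow> (\<exists>u. \<phi> = All \<cdot> u \<and> {||} \<turnstile> All \<cdot> Lam (is_B (up u \<cdot> Var 0)))"

lemma certified_example: "certified (All \<cdot> Lam (is_N Zero))"
proof -
  define G where "G = {|is_N (Var 0)|}"
  define a where "a = Lam (is_N Zero) \<cdot> Var 0"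
  define b where "b = Lam (is_B (Lam (is_N Zero) \<cdot> Var 0))"
  define js where "js = [(G, is_N Zero), (G, a), (G, is_B a), (G, b \<cdot> Var 0), ({||}, All \<cdot> b)]"
  have ab: "a \<rhd> is_N Zero" "b \<cdot> Var 0 \<rhd> is_B a"
    unfolding a_def b_def using beta[of "is_N Zero" "Var 0"]
      beta[of "is_B (Lam (is_N Zero) \<cdot> Var 0)" "Var 0"] by simp_all
  have up_b: "up b = b" by (simp add: b_def)
  have "oga_rule {} (G, is_N Zero)"
    by (intro oga_rule.rga rga_rule.zeroN)
  moreover have "oga_rule {(G, is_N Zero)} (G, a)"
    by (rule oga_rule.rga, rule rga_rule.conv_expand[OF ab(1)]) simp
  moreover have "oga_rule {(G, is_N Zero), (G, a)} (G, is_B a)"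
    by (rule oga_rule.rga, rule rga_rule.orI1) simp
  moreover have "oga_rule {(G, is_N Zero), (G, a), (G, is_B a)} (G, b \<cdot> Var 0)"
    by (rule oga_rule.rga, rule rga_rule.conv_expand[OF ab(2)]) simp
  moreover have "oga_rule {(G, is_N Zero), (G, a), (G, is_B a), (G, b \<cdot> Var 0)} ({||}, All \<cdot> b)"
    by (rule oga_rule.rga, rule rga_rule.allI) (simp add: G_def up_b)
  ultimately have "is_proof oga_rule js"
    unfolding is_proof_def js_def by (simp add: less_Suc_eq_0_disj all_conj_distrib) auto
  then have "{||} \<turnstile> All \<cdot> b"
    unfolding oga_def by (intro exI[of _ js]) (simp add: js_def)
  then show ?thesis by (simp add: certified_def b_def)
qed

typedef certified_universal = "{\<phi>. certified \<phi>}"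
  morphisms universal_of Certified
  using certified_example by blast

type_synonym fafi_value = "certified_universal fba"

text \<open>\<open>x\<^bsub>\<phi>\<^esub>\<close>; meaningful for certified \<open>\<phi>\<close> only.\<close>

definition fafi_atom :: "tm \<Rightarrow> fafi_value" where
  "fafi_atom \<phi> = fba_atom (Certified \<phi>)"

inductive evaluates :: "tm \<Rightarrow> fafi_value \<Rightarrow> bool"  (infix "\<leadsto>" 45) where
  proved: "{||} \<turnstile> \<phi> \<Longrightarrow> \<phi> \<leadsto> top"
| refuted: "{||} \<turnstile> Neg \<phi> \<Longrightarrow> \<phi> \<leadsto> bot"
| neg: "\<phi> \<leadsto> p \<Longrightarrow> Neg \<phi> \<leadsto> - p"
| or: "\<phi> \<leadsto> p \<Longrightarrow> \<psi> \<leadsto> q \<Longrightarrow> (\<phi> \<squnion> \<psi>) \<leadsto> sup p q"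
| univ: "certified (All \<cdot> u) \<Longrightarrow> All \<cdot> u \<leadsto> fafi_atom (All \<cdot> u)"

text \<open>The condition on \<open>fv\<close> says that \<open>\<phi>\<close> is a sentence.\<close>

definition genuine_fiction :: "tm \<Rightarrow> bool" where
  "genuine_fiction \<phi> \<longleftrightarrow> fv \<phi> = {} \<and> (\<exists>p. \<phi> \<leadsto> p) \<and> \<not> ({||} \<turnstile> \<phi>) \<and> \<not> ({||} \<turnstile> Neg \<phi>)"

end

theory Submission
  imports Defs
begin

text \<open>Weak head evaluation of terms to natural numbers, with an infinitary clause for the quantifier,
  is a model of OGA: truth is evaluation to \<open>1\<close>, falsity evaluation to \<open>0\<close>, and ATI is sound because
  the quantifier ranges over the standard numerals. Compiled definitions evaluate to the functions
  they define, so a search sentence that is true is true in the model; hence it is irrefutable and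
  consistent with OGA. That it is Boolean follows by two uses of ATI, since OGA proves compiled
  definitions total by induction.\<close>

section \<open>Parallel substitution\<close>

text \<open>Evaluation is partial: divergent terms, abstractions and free variables have no value,
  so a term may be neither true nor false. Consistency is uniqueness of values, which rests on
  determinism of head evaluation. The obstacle is the rule \<open>eq_subst\<close>. It may exchange
  two terms of equal value below binders, in arguments and in head position, although the two reduce
  in different ways. The remedy is a simulation between terms that differ only in subterms of equal
  value. Soundness is stated for all assignments of terms to variables. A hypothesis
  \<open>is_N (Var i)\<close> holds exactly when the term assigned to \<open>i\<close> has a value,
  and every such term can be exchanged for a numeral. This is how rules about arbitrary denoting
  terms agree with a quantifier over numerals.\<close>

definition lift_sub :: "(nat \<Rightarrow> tm) \<Rightarrow> nat \<Rightarrow> tm" where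
  "lift_sub \<sigma> = case_nat (Var 0) (\<lambda>j. up (\<sigma> j))"

text \<open>\<open>lift_from\<close>, \<open>subst\<close> and \<open>inst\<close> are instances, so
  their commutation laws all follow from one composition law. The same operation serves as the
  assignment of terms to variables in the soundness proof.\<close>

primrec psubst :: "(nat \<Rightarrow> tm) \<Rightarrow> tm \<Rightarrow> tm" where
  "psubst \<sigma> (Var i) = \<sigma> i"
| "psubst \<sigma> Bot = Bot"
| "psubst \<sigma> Zero = Zero"
| "psubst \<sigma> (S t) = S (psubst \<sigma> t)"
| "psubst \<sigma> (t \<doteq> u) = (psubst \<sigma> t \<doteq> psubst \<sigma> u)"
| "psubst \<sigma> (Neg t) = Neg (psubst \<sigma> t)"
| "psubst \<sigma> (t \<squnion> u) = (psubst \<sigma> t \<squnion> psubst \<sigma> u)"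
| "psubst \<sigma> (Lam t) = Lam (psubst (lift_sub \<sigma>) t)"
| "psubst \<sigma> (t \<cdot> u) = psubst \<sigma> t \<cdot> psubst \<sigma> u"
| "psubst \<sigma> Rec = Rec"
| "psubst \<sigma> All = All"

lemma lift_sub_simps [simp]:
  "lift_sub \<sigma> 0 = Var 0" "lift_sub \<sigma> (Suc i) = up (\<sigma> i)"
  by (simp_all add: lift_sub_def)

lemma psubst_cong: "(\<And>i. i \<in> fv t \<Longrightarrow> \<sigma> i = \<tau> i) \<Longrightarrow> psubst \<sigma> t = psubst \<tau> t"
proof (induction t arbitrary: \<sigma> \<tau>)
  case (Lam t)
  have "lift_sub \<sigma> i = lift_sub \<tau> i" if "i \<in> fv t" for i
    using that Lam.prems by (cases i) auto
  then show ?case using Lam.IH[of "lift_sub \<sigma>" "lift_sub \<tau>"] by simp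
next
  case (S t)
  from S.IH[of \<sigma> \<tau>] S.prems show ?case by simp
next
  case (Neg t)
  from Neg.IH[of \<sigma> \<tau>] Neg.prems show ?case by simp
next
  case (Eq t u)
  from Eq.IH(1,2)[of \<sigma> \<tau>] Eq.prems show ?case by simp
next
  case (Or t u)
  from Or.IH(1,2)[of \<sigma> \<tau>] Or.prems show ?case by simp
next
  case (App t u)
  from App.IH(1,2)[of \<sigma> \<tau>] App.prems show ?case by simp
qed simp_all

lemma lift_sub_Var [simp]: "lift_sub Var = Var"
proof
  show "lift_sub Var i = Var i" for i by (cases i) simp_all
qed

lemma psubst_Var [simp]: "psubst Var t = t"
  by (induction t) simp_all

lemma psubst_closed: "fv t = {} \<Longrightarrow> psubst \<sigma> t = t"
  using psubst_cong[of t \<sigma> Var] by simp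

lemma lift_from_eq: "lift_from k t = psubst (\<lambda>i. Var (if i < k then i else Suc i)) t"
proof (induction t arbitrary: k)
  case (Lam t)
  have "lift_sub (\<lambda>i. Var (if i < k then i else Suc i))
      = (\<lambda>i. Var (if i < Suc k then i else Suc i))"
  proof
    show "lift_sub (\<lambda>i. Var (if i < k then i else Suc i)) i
      = Var (if i < Suc k then i else Suc i)" for i by (cases i) auto
  qed
  with Lam show ?case by simp
qed simp_all

lemma subst_eq: "subst i s t = psubst (Var(i := s)) t"
proof (induction t arbitrary: i s)
  case (Lam t)
  have "lift_sub (Var(i := s)) = Var(Suc i := up s)"
  proof
    show "lift_sub (Var(i := s)) j = (Var(Suc i := up s)) j" for j by (cases j) auto
  qed
  then show ?case by (simp only: subst.simps psubst.simps Lam.IH)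
qed simp_all

lemma inst_eq: "inst k s t = psubst (\<lambda>j. if j < k then Var j else if j = k then s else Var (j - 1)) t"
proof (induction t arbitrary: k s)
  case (Lam t)
  have "lift_sub (\<lambda>j. if j < k then Var j else if j = k then s else Var (j - 1))
      = (\<lambda>j. if j < Suc k then Var j else if j = Suc k then up s else Var (j - 1))"
    (is "?l = ?r")
  proof
    show "?l j = ?r j" for j by (cases j) auto
  qed
  with Lam show ?case by simp
qed simp_all

lemma up_eq: "up t = psubst (\<lambda>i. Var (Suc i)) t"
  by (simp add: lift_from_eq)

lemma lift_sub_ren: "lift_sub (\<lambda>i. Var (\<rho> i)) = (\<lambda>i. Var (case_nat 0 (\<lambda>j. Suc (\<rho> j)) i))"
proof
  show "lift_sub (\<lambda>i. Var (\<rho> i)) i = Var (case_nat 0 (\<lambda>j. Suc (\<rho> j)) i)" for i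
    by (cases i) simp_all
qed

text \<open>Composition takes three stages: a renaming inside, a renaming outside, then the general
  law. The binder case of each later stage has to move \<open>up\<close> past a substitution, and
  \<open>up\<close> is itself a renaming.\<close>

lemma psubst_ren: "psubst \<sigma> (psubst (\<lambda>i. Var (\<rho> i)) t) = psubst (\<lambda>i. \<sigma> (\<rho> i)) t"
proof (induction t arbitrary: \<sigma> \<rho>)
  case (Lam t)
  have "(\<lambda>i. lift_sub \<sigma> (case_nat 0 (\<lambda>j. Suc (\<rho> j)) i)) = lift_sub (\<lambda>i. \<sigma> (\<rho> i))"
  proof
    show "lift_sub \<sigma> (case_nat 0 (\<lambda>j. Suc (\<rho> j)) i) = lift_sub (\<lambda>i. \<sigma> (\<rho> i)) i" for i
      by (cases i) simp_all
  qed
  with Lam show ?case by (simp add: lift_sub_ren)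
qed simp_all

lemma psubst_up: "psubst \<sigma> (up t) = psubst (\<lambda>i. \<sigma> (Suc i)) t"
  by (simp add: up_eq psubst_ren)

lemma ren_psubst:
  "psubst (\<lambda>i. Var (\<rho> i)) (psubst \<sigma> t) = psubst (\<lambda>i. psubst (\<lambda>i. Var (\<rho> i)) (\<sigma> i)) t"
proof (induction t arbitrary: \<sigma> \<rho>)
  case (Lam t)
  have "(\<lambda>i. psubst (lift_sub (\<lambda>i. Var (\<rho> i))) (lift_sub \<sigma> i))
      = lift_sub (\<lambda>i. psubst (\<lambda>i. Var (\<rho> i)) (\<sigma> i))" (is "?l = ?r")
  proof
    show "?l i = ?r i" for i
      by (cases i) (simp_all add: psubst_up, simp add: up_eq psubst_ren)
  qed
  with Lam show ?case by (simp add: lift_sub_ren)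
qed simp_all

lemma psubst_lift_sub_up: "psubst (lift_sub \<sigma>) (up t) = up (psubst \<sigma> t)"
  by (simp add: psubst_up) (simp add: up_eq ren_psubst)

lemma psubst_psubst: "psubst \<sigma> (psubst \<tau> t) = psubst (\<lambda>i. psubst \<sigma> (\<tau> i)) t"
proof (induction t arbitrary: \<sigma> \<tau>)
  case (Lam t)
  have "(\<lambda>i. psubst (lift_sub \<sigma>) (lift_sub \<tau> i)) = lift_sub (\<lambda>i. psubst \<sigma> (\<tau> i))" (is "?l = ?r")
  proof
    show "?l i = ?r i" for i by (cases i) (simp_all add: psubst_lift_sub_up)
  qed
  with Lam show ?case by simp
qed simp_all

text \<open>Contracting an instantiated abstraction amounts to extending the environment by the
  argument. Both the soundness of ATI and the unfolding of curried terms use beta steps in this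
  form.\<close>

lemma inst_psubst_lift_sub: "inst 0 s (psubst (lift_sub \<sigma>) t) = psubst (case_nat s \<sigma>) t"
proof -
  have "(\<lambda>i. psubst (\<lambda>j. if j < 0 then Var j else if j = 0 then s else Var (j - 1)) (lift_sub \<sigma> i))
      = case_nat s \<sigma>" (is "?l = ?r")
  proof
    show "?l i = ?r i" for i by (cases i) (simp_all add: psubst_up)
  qed
  then show ?thesis by (simp add: inst_eq psubst_psubst)
qed

lemma psubst_inst: "psubst \<sigma> (inst 0 s t) = inst 0 (psubst \<sigma> s) (psubst (lift_sub \<sigma>) t)"
proof -
  have "psubst \<sigma> (inst 0 s t) = psubst \<sigma> (psubst (case_nat s Var) t)"
    using inst_psubst_lift_sub[of s Var t] by simp
  also have "\<dots> = psubst (case_nat (psubst \<sigma> s) \<sigma>) t"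
    unfolding psubst_psubst by (rule psubst_cong) (simp split: nat.split)
  finally show ?thesis by (simp add: inst_psubst_lift_sub)
qed

lemma psubst_subst: "psubst \<sigma> (subst i s t) = psubst (\<sigma>(i := psubst \<sigma> s)) t"
  unfolding subst_eq psubst_psubst by (rule psubst_cong) simp

lemma subst_fresh: "i \<notin> fv t \<Longrightarrow> subst i s t = t"
  unfolding subst_eq using psubst_cong[of t "Var(i := s)" Var] by fastforce

lemma finite_fv: "finite (fv t)"
proof (induction t)
  case (Lam t)
  have "{i. Suc i \<in> fv t} = Suc -` fv t" by auto
  with Lam show ?case by (simp add: finite_vimageI)
qed simp_all

lemma fresh_index: "finite A \<Longrightarrow> \<exists>i. \<forall>t\<in>A. i \<notin> fv t"
  using finite_fv ex_new_if_finite[OF infinite_UNIV_nat, of "\<Union>(fv ` A)"] by auto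

lemma numeral_tm_simps [simp]: "numeral_tm 0 = Zero" "numeral_tm (Suc n) = S (numeral_tm n)"
  by (simp_all add: numeral_tm_def)

lemma psubst_numeral [simp]: "psubst \<sigma> (numeral_tm n) = numeral_tm n"
  by (induction n) simp_all

lemma head_step_psubst: "t \<rhd> t' \<Longrightarrow> psubst \<sigma> t \<rhd> psubst \<sigma> t'"
  by (induction rule: head_step.induct) (auto simp: psubst_inst intro: head_step.intros)


section \<open>A model of the calculus\<close>

text \<open>Indexed by the value of the recursion argument rather than by its shape: the term that
  had this value is forgotten and only its numeral enters the contractum.\<close>

fun rec_unfold :: "tm \<Rightarrow> tm \<Rightarrow> nat \<Rightarrow> tm" where
  "rec_unfold g h 0 = g"
| "rec_unfold g h (Suc k) = h \<cdot> numeral_tm k \<cdot> (Rec \<cdot> g \<cdot> h \<cdot> numeral_tm k)"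

text \<open>A recursion argument may be any term with a value, not only a numeral: otherwise \<open>rec_eq\<close> would
  fail and values would not be invariant under replacing equals.\<close>

inductive val :: "tm \<Rightarrow> nat \<Rightarrow> bool" and wstep :: "tm \<Rightarrow> tm \<Rightarrow> bool" where
  val_Zero: "val Zero 0"
| val_S: "val t n \<Longrightarrow> val (S t) (Suc n)"
| val_Eq1: "val t n \<Longrightarrow> val u n \<Longrightarrow> val (t \<doteq> u) 1"
| val_Eq0: "val t n \<Longrightarrow> val u m \<Longrightarrow> n \<noteq> m \<Longrightarrow> val (t \<doteq> u) 0"
| val_Neg0: "val t 1 \<Longrightarrow> val (Neg t) 0"
| val_Neg1: "val t 0 \<Longrightarrow> val (Neg t) 1"
| val_Or1: "val t 1 \<Longrightarrow> val (t \<squnion> u) 1"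
| val_Or2: "val u 1 \<Longrightarrow> val (t \<squnion> u) 1"
| val_Or0: "val t 0 \<Longrightarrow> val u 0 \<Longrightarrow> val (t \<squnion> u) 0"
| val_All1: "(\<And>n. val (f \<cdot> numeral_tm n) 1) \<Longrightarrow> val (All \<cdot> f) 1"
| val_All0: "val (f \<cdot> numeral_tm n) 0 \<Longrightarrow> val (All \<cdot> f) 0"
| val_wstep: "wstep t s \<Longrightarrow> val s n \<Longrightarrow> val t n"
| wstep_beta: "wstep (Lam b \<cdot> t) (inst 0 t b)"
| wstep_Rec: "val m k \<Longrightarrow> wstep (Rec \<cdot> g \<cdot> h \<cdot> m) (rec_unfold g h k)"
| wstep_app: "wstep t s \<Longrightarrow> wstep (t \<cdot> u) (s \<cdot> u)"

section \<open>Inversion and determinism of evaluation\<close>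

inductive_cases wstep_cases:
  "wstep (Var i) s" "wstep Bot s" "wstep Zero s" "wstep (S t) s" "wstep (t \<doteq> u) s" "wstep (Neg t) s"
  "wstep (t \<squnion> u) s" "wstep (Lam t) s" "wstep Rec s" "wstep All s"

lemma not_wstep [simp]:
  "\<not> wstep (Var i) s" "\<not> wstep Bot s" "\<not> wstep Zero s" "\<not> wstep (S t) s" "\<not> wstep (t \<doteq> u) s"
  "\<not> wstep (Neg t) s" "\<not> wstep (t \<squnion> u) s" "\<not> wstep (Lam t) s" "\<not> wstep Rec s" "\<not> wstep All s"
  by (auto elim: wstep_cases)

inductive_cases wstep_appE: "wstep (t \<cdot> u) s"

lemma not_wstep_app [simp]:
  "\<not> wstep (All \<cdot> f) s" "\<not> wstep (Rec \<cdot> g) s" "\<not> wstep (Rec \<cdot> g \<cdot> h) s"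
  by (auto elim!: wstep_appE)

lemma val_simps [simp]:
  "\<not> val (Var i) n" "\<not> val Bot n" "\<not> val (Lam t) n" "\<not> val Rec n" "\<not> val All n"
  "\<not> val (Rec \<cdot> g) n" "\<not> val (Rec \<cdot> g \<cdot> h) n"
  by (auto elim: val.cases)

lemma val_Zero_iff [simp]: "val Zero n \<longleftrightarrow> n = 0"
  by (auto elim: val.cases intro: val_Zero)

lemma val_S_iff [simp]: "val (S t) n \<longleftrightarrow> (\<exists>m. n = Suc m \<and> val t m)"
  by (auto elim: val.cases intro: val_S)

lemma val_Neg_iff [simp]: "val (Neg t) n \<longleftrightarrow> n = 0 \<and> val t 1 \<or> n = 1 \<and> val t 0"
  by (auto elim: val.cases intro: val_Neg0[simplified] val_Neg1[simplified])

lemma val_Or_iff [simp]: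
  "val (t \<squnion> u) n \<longleftrightarrow> n = 1 \<and> (val t 1 \<or> val u 1) \<or> n = 0 \<and> val t 0 \<and> val u 0"
  by (auto elim: val.cases intro: val_Or0 val_Or1[simplified] val_Or2[simplified])

inductive_cases val_EqE: "val (t \<doteq> u) n"
inductive_cases val_AllE: "val (All \<cdot> f) n"

lemma val_Eq_iff:
  "val (t \<doteq> u) n \<longleftrightarrow> (\<exists>k. val t k \<and> val u k \<and> n = 1)
     \<or> (\<exists>k m. val t k \<and> val u m \<and> k \<noteq> m \<and> n = 0)"
  by (auto elim!: val_EqE intro: val_Eq0 val_Eq1[simplified])

lemma val_All_iff:
  "val (All \<cdot> f) n \<longleftrightarrow>
     n = 1 \<and> (\<forall>k. val (f \<cdot> numeral_tm k) 1) \<or> n = 0 \<and> (\<exists>k. val (f \<cdot> numeral_tm k) 0)"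
  by (auto elim!: val_AllE intro: val_All0 val_All1[simplified])

lemma val_numeral [simp]: "val (numeral_tm n) m \<longleftrightarrow> m = n"
  by (induction n arbitrary: m) auto

text \<open>The two halves need each other: a recursor step depends on the value of its argument,
  and a value may come from a step. For quantifiers, a counterexample in the sense of
  \<open>val_All0\<close> is a numeral instance whose value is already fixed to 1 by the premises of
  \<open>val_All1\<close>.\<close>

lemma val_wstep_deterministic:
  "val t n \<Longrightarrow> (\<And>m. val t m \<Longrightarrow> n = m)"
  "wstep t s \<Longrightarrow> (\<And>s'. wstep t s' \<Longrightarrow> s = s')"
proof (induction rule: val_wstep.inducts)
  case val_Zero
  then show ?case by simp
next
  case (val_S t n)
  from val_S.prems show ?case by (auto dest!: val_S.IH)
next
  case (val_Eq1 t n u)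
  from val_Eq1.prems show ?case by (auto simp: val_Eq_iff dest!: val_Eq1.IH)
next
  case (val_Eq0 t n u k)
  from val_Eq0.prems \<open>n \<noteq> k\<close> show ?case by (auto simp: val_Eq_iff dest!: val_Eq0.IH)
next
  case (val_Neg0 t)
  from val_Neg0.prems show ?case by (auto dest!: val_Neg0.IH)
next
  case (val_Neg1 t)
  from val_Neg1.prems show ?case by (auto dest!: val_Neg1.IH)
next
  case (val_Or1 t u)
  from val_Or1.prems show ?case by (auto dest!: val_Or1.IH)
next
  case (val_Or2 u t)
  from val_Or2.prems show ?case by (auto dest!: val_Or2.IH)
next
  case (val_Or0 t u)
  from val_Or0.prems show ?case by (auto dest!: val_Or0.IH)
next
  case (val_All1 f)
  from val_All1.prems show ?case by (auto simp: val_All_iff dest!: val_All1.IH)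
next
  case (val_All0 f n)
  from val_All0.prems show ?case by (auto simp: val_All_iff dest!: val_All0.IH)
next
  case (val_wstep t s n)
  from val_wstep.prems show ?case
    by (cases rule: val.cases) (use val_wstep.hyps in \<open>auto dest!: val_wstep.IH\<close>)
next
  case (wstep_beta b t)
  then show ?case by (auto elim: wstep_appE)
next
  case (wstep_Rec m k g h)
  from wstep_Rec.prems show ?case
    by (rule wstep_appE) (auto dest!: wstep_Rec.IH)
next
  case (wstep_app t s u)
  from wstep_app.prems show ?case
    by (rule wstep_appE) (use wstep_app.hyps in \<open>auto dest!: wstep_app.IH\<close>)
qed

lemmas val_unique = val_wstep_deterministic(1)
lemmas wstep_unique = val_wstep_deterministic(2)

lemma val_wstep_iff: "wstep t s \<Longrightarrow> val t n \<longleftrightarrow> val s n"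
proof
  assume "wstep t s" "val t n"
  from \<open>val t n\<close> show "val s n"
    using \<open>wstep t s\<close> wstep_unique by (cases rule: val.cases) auto
qed (rule val_wstep)

text \<open>A free variable has no value and takes no step, so an evaluation that succeeds never
  depends on one.\<close>

lemma val_psubst:
  "val t n \<Longrightarrow> val (psubst \<sigma> t) n"
  "wstep t s \<Longrightarrow> wstep (psubst \<sigma> t) (psubst \<sigma> s)"
proof (induction rule: val_wstep.inducts)
  case (wstep_Rec m k g h)
  have "psubst \<sigma> (rec_unfold g h k) = rec_unfold (psubst \<sigma> g) (psubst \<sigma> h) k"
    by (cases k) simp_all
  with wstep_Rec show ?case by (simp add: val_wstep.wstep_Rec)
next
  case (val_Eq1 t n u)
  then show ?case by (auto simp: val_Eq_iff)
next
  case (val_Eq0 t n u m)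
  then show ?case by (auto simp: val_Eq_iff)
next
  case (val_All1 f)
  then show ?case by (simp add: val_All_iff)
next
  case (val_All0 f n)
  then show ?case by (auto simp: val_All_iff)
next
  case (val_wstep t s n)
  then show ?case using val_wstep_iff by blast
next
  case (wstep_beta b t)
  then show ?case by (simp add: psubst_inst val_wstep.wstep_beta)
next
  case (wstep_app t s u)
  then show ?case by (simp add: val_wstep.wstep_app)
qed simp_all

section \<open>Invariance of values under replacement of equals\<close>

lemma apps_simps [simp]: "apps t [] = t" "apps t (u # us) = apps (t \<cdot> u) us"
  by (simp_all add: apps_def)

lemma wstep_apps: "wstep t s \<Longrightarrow> wstep (apps t us) (apps s us)"
  by (induction us arbitrary: t s) (auto intro: wstep_app)

text \<open>When a subterm in head position is exchanged for one with the same value, neither of the two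
  applications has a value: terms with a value become dead once they are applied.\<close>

definition dead :: "tm \<Rightarrow> bool" where
  "dead t \<longleftrightarrow> (\<forall>us n. \<not> val (apps t us) n)"

lemma dead_app: "dead t \<Longrightarrow> dead (t \<cdot> u)"
  unfolding dead_def by (metis apps_simps(2))

lemma dead_wstep_iff: "wstep t s \<Longrightarrow> dead t \<longleftrightarrow> dead s"
  unfolding dead_def using val_wstep_iff wstep_apps by blast

text \<open>The excluded shapes are those that further arguments may turn into a redex or, for
  \<open>All\<close>, into a term with a value.\<close>

definition inert :: "tm \<Rightarrow> bool" where
  "inert t \<longleftrightarrow> (\<nexists>s. wstep t s) \<and> (\<nexists>b. t = Lam b) \<and> t \<noteq> All
     \<and> t \<noteq> Rec \<and> (\<nexists>g. t = Rec \<cdot> g) \<and> (\<nexists>g h. t = Rec \<cdot> g \<cdot> h)"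

lemma inert_app:
  assumes "inert t"
  shows "inert (t \<cdot> u)" "\<not> val (t \<cdot> u) n"
proof -
  have no: "\<not> wstep (t \<cdot> u) s" for s
    using assms by (auto simp: inert_def elim: wstep_appE)
  then show "inert (t \<cdot> u)" using assms by (auto simp: inert_def)
  show "\<not> val (t \<cdot> u) n"
  proof
    assume "val (t \<cdot> u) n"
    then show False using no assms by cases (auto simp: inert_def)
  qed
qed

lemma inert_dead:
  assumes "inert t"
  shows "dead (t \<cdot> u)"
proof -
  have "\<not> val (apps (t \<cdot> u) us) n" for us n
    using assms by (induction us arbitrary: t u) (simp_all add: inert_app)
  then show ?thesis by (simp add: dead_def)
qed

text \<open>A value that does not come from a step belongs to a term built by a number or truth
  value constructor or of the form \<open>All \<cdot> f\<close>; all of these are inert. Deadness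
  then travels backwards along steps.\<close>

lemma val_dead_app: "val t n \<Longrightarrow> dead (t \<cdot> u)"
proof (induction t n arbitrary: u rule: val_wstep.inducts(1)[where ?P2.0="\<lambda>_ _. True"])
  case (val_wstep t s n)
  then show ?case using dead_wstep_iff wstep_app by blast
qed (auto intro!: inert_dead simp: inert_def)

text \<open>Replacing subterms, also below binders, by terms with the same value. That \<open>rel\<close> preserves
  values is what makes the substitution rule for equations sound.\<close>

inductive rel :: "tm \<Rightarrow> tm \<Rightarrow> bool" where
  rel_val: "val a n \<Longrightarrow> val b n \<Longrightarrow> rel a b"
| rel_refl: "rel t t"
| rel_S: "rel t t' \<Longrightarrow> rel (S t) (S t')"
| rel_Eq: "rel t t' \<Longrightarrow> rel u u' \<Longrightarrow> rel (t \<doteq> u) (t' \<doteq> u')"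
| rel_Neg: "rel t t' \<Longrightarrow> rel (Neg t) (Neg t')"
| rel_Or: "rel t t' \<Longrightarrow> rel u u' \<Longrightarrow> rel (t \<squnion> u) (t' \<squnion> u')"
| rel_Lam: "rel t t' \<Longrightarrow> rel (Lam t) (Lam t')"
| rel_App: "rel t t' \<Longrightarrow> rel u u' \<Longrightarrow> rel (t \<cdot> u) (t' \<cdot> u')"

lemma rel_psubst1: "rel t t' \<Longrightarrow> rel (psubst \<sigma> t) (psubst \<sigma> t')"
  by (induction arbitrary: \<sigma> rule: rel.induct) (auto intro: rel.intros val_psubst(1))

lemma rel_lift_sub: "(\<And>i. rel (\<sigma> i) (\<tau> i)) \<Longrightarrow> rel (lift_sub \<sigma> i) (lift_sub \<tau> i)"
  by (cases i) (auto simp: up_eq intro: rel_psubst1 rel_refl)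

lemma rel_psubst2: "(\<And>i. rel (\<sigma> i) (\<tau> i)) \<Longrightarrow> rel (psubst \<sigma> t) (psubst \<tau> t)"
  by (induction t arbitrary: \<sigma> \<tau>) (simp_all add: rel.intros(2-) rel_lift_sub)

lemma rel_psubst:
  "rel t t' \<Longrightarrow> (\<And>i. rel (\<sigma> i) (\<tau> i)) \<Longrightarrow> rel (psubst \<sigma> t) (psubst \<tau> t')"
proof (induction arbitrary: \<sigma> \<tau> rule: rel.induct)
  case (rel_val a n b)
  then show ?case by (blast intro: rel.rel_val val_psubst(1))
qed (simp_all add: rel.intros(2-) rel_lift_sub rel_psubst2)

lemma rel_inst: "rel t t' \<Longrightarrow> rel b b' \<Longrightarrow> rel (inst 0 t b) (inst 0 t' b')"
  unfolding inst_eq by (rule rel_psubst) (auto intro: rel_refl)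

inductive_cases rel_appE: "rel (t \<cdot> u) t'"
inductive_cases rel_LamE: "rel (Lam t) t'"
inductive_cases rel_RecE: "rel Rec t'"
inductive_cases rel_AllE: "rel All t'"

lemma rel_heads [simp]: "rel Rec t \<longleftrightarrow> t = Rec" "rel All t \<longleftrightarrow> t = All"
  by (auto elim: rel_RecE rel_AllE intro: rel_refl)

text \<open>Inversion of \<open>rel\<close> when the left side has a value. The clauses
  \<open>rel_val\<close> and \<open>rel_refl\<close> are settled here once and for all, so that each
  constructor leaves only its congruence clause.\<close>

lemma rel_val_cases:
  "rel (S t) s \<Longrightarrow> val (S t) n \<Longrightarrow> (\<And>t'. s = S t' \<Longrightarrow> rel t t' \<Longrightarrow> val s n) \<Longrightarrow> val s n"
  "rel (Neg t) s \<Longrightarrow> val (Neg t) n \<Longrightarrow> (\<And>t'. s = Neg t' \<Longrightarrow> rel t t' \<Longrightarrow> val s n) \<Longrightarrow> val s n"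
  "rel (t \<doteq> u) s \<Longrightarrow> val (t \<doteq> u) n
    \<Longrightarrow> (\<And>t' u'. s = (t' \<doteq> u') \<Longrightarrow> rel t t' \<Longrightarrow> rel u u' \<Longrightarrow> val s n) \<Longrightarrow> val s n"
  "rel (t \<squnion> u) s \<Longrightarrow> val (t \<squnion> u) n
    \<Longrightarrow> (\<And>t' u'. s = (t' \<squnion> u') \<Longrightarrow> rel t t' \<Longrightarrow> rel u u' \<Longrightarrow> val s n) \<Longrightarrow> val s n"
  "rel (t \<cdot> u) s \<Longrightarrow> val (t \<cdot> u) n
    \<Longrightarrow> (\<And>t' u'. s = t' \<cdot> u' \<Longrightarrow> rel t t' \<Longrightarrow> rel u u' \<Longrightarrow> val s n) \<Longrightarrow> val s n"
  by (erule rel.cases; use val_unique rel_refl in blast)+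

text \<open>A step of \<open>t\<close> need not be matched when \<open>t\<close> and
  \<open>t'\<close> are related merely by a common value. Once such a term is applied to an argument
  it is dead by \<open>val_dead_app\<close>, and deadness persists under further application. A term
  with a value is not dead, so values are transferred in the remaining alternatives.\<close>

lemma rel_simulation:
  "val t n \<Longrightarrow> (\<And>t'. rel t t' \<Longrightarrow> val t' n)"
  "wstep t s \<Longrightarrow> (\<And>t'. rel t t' \<Longrightarrow>
     (\<exists>m. val t m \<and> val t' m) \<or> dead t \<or> (\<exists>s'. wstep t' s' \<and> rel s s'))"
proof (induction rule: val_wstep.inducts)
  case val_Zero
  from val_Zero.prems show ?case by cases auto
next
  case (val_S t n s)
  show ?case
  proof (rule rel_val_cases(1)[OF val_S.prems])
    show "val (S t) (Suc n)" using val_S.hyps by (rule val_wstep.val_S)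
    show "val s (Suc n)" if "s = S t'" "rel t t'" for t'
      unfolding that(1) using val_S.IH that(2-) by (blast intro: val_wstep.val_S)
  qed
next
  case (val_Eq1 t n u s)
  show ?case
  proof (rule rel_val_cases(3)[OF val_Eq1.prems])
    show "val (t \<doteq> u) 1" using val_Eq1.hyps by (rule val_wstep.val_Eq1)
    show "val s 1" if "s = (t' \<doteq> u')" "rel t t'" "rel u u'" for t' u'
      unfolding that(1) using val_Eq1.IH that(2-) by (blast intro: val_wstep.val_Eq1)
  qed
next
  case (val_Eq0 t n u k s)
  show ?case
  proof (rule rel_val_cases(3)[OF val_Eq0.prems])
    show "val (t \<doteq> u) 0" using val_Eq0.hyps by (rule val_wstep.val_Eq0)
    show "val s 0" if "s = (t' \<doteq> u')" "rel t t'" "rel u u'" for t' u'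
      unfolding that(1) using val_Eq0.IH that(2-) \<open>n \<noteq> k\<close> by (blast intro: val_wstep.val_Eq0)
  qed
next
  case (val_Neg0 t s)
  show ?case
  proof (rule rel_val_cases(2)[OF val_Neg0.prems])
    show "val (Neg t) 0" using val_Neg0.hyps by (rule val_wstep.val_Neg0)
    show "val s 0" if "s = Neg t'" "rel t t'" for t'
      unfolding that(1) using val_Neg0.IH that(2-) by (blast intro: val_wstep.val_Neg0)
  qed
next
  case (val_Neg1 t s)
  show ?case
  proof (rule rel_val_cases(2)[OF val_Neg1.prems])
    show "val (Neg t) 1" using val_Neg1.hyps by (rule val_wstep.val_Neg1)
    show "val s 1" if "s = Neg t'" "rel t t'" for t'
      unfolding that(1) using val_Neg1.IH that(2-) by (blast intro: val_wstep.val_Neg1)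
  qed
next
  case (val_Or1 t u s)
  show ?case
  proof (rule rel_val_cases(4)[OF val_Or1.prems])
    show "val (t \<squnion> u) 1" using val_Or1.hyps by (rule val_wstep.val_Or1)
    show "val s 1" if "s = (t' \<squnion> u')" "rel t t'" "rel u u'" for t' u'
      unfolding that(1) using val_Or1.IH that(2-) by (blast intro: val_wstep.val_Or1)
  qed
next
  case (val_Or2 u t s)
  show ?case
  proof (rule rel_val_cases(4)[OF val_Or2.prems])
    show "val (t \<squnion> u) 1" using val_Or2.hyps by (rule val_wstep.val_Or2)
    show "val s 1" if "s = (t' \<squnion> u')" "rel t t'" "rel u u'" for t' u'
      unfolding that(1) using val_Or2.IH that(2-) by (blast intro: val_wstep.val_Or2)
  qed
next
  case (val_Or0 t u s)
  show ?case
  proof (rule rel_val_cases(4)[OF val_Or0.prems])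
    show "val (t \<squnion> u) 0" using val_Or0.hyps by (rule val_wstep.val_Or0)
    show "val s 0" if "s = (t' \<squnion> u')" "rel t t'" "rel u u'" for t' u'
      unfolding that(1) using val_Or0.IH that(2-) by (blast intro: val_wstep.val_Or0)
  qed
next
  case (val_All1 f s)
  show ?case
  proof (rule rel_val_cases(5)[OF val_All1.prems])
    show "val (All \<cdot> f) 1" using val_All1.hyps by (rule val_wstep.val_All1)
    show "val s 1" if "s = f' \<cdot> u'" "rel All f'" "rel f u'" for f' u'
      using that val_All1.IH by (auto intro!: val_wstep.val_All1[simplified] intro: rel_App rel_refl)
  qed
next
  case (val_All0 f n s)
  show ?case
  proof (rule rel_val_cases(5)[OF val_All0.prems])
    show "val (All \<cdot> f) 0" using val_All0.hyps by (rule val_wstep.val_All0)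
    show "val s 0" if "s = f' \<cdot> u'" "rel All f'" "rel f u'" for f' u'
      using that val_All0.IH by (auto intro!: val_wstep.val_All0[of _ n] intro: rel_App rel_refl)
  qed
next
  case (val_wstep t s n t')
  have v: "val t n" using val_wstep.hyps by (rule val_wstep.val_wstep)
  then have "\<not> dead t" unfolding dead_def by (metis apps_simps(1))
  with val_wstep.IH(1)[OF val_wstep.prems]
  consider m where "val t m" "val t' m" | s' where "wstep t' s'" "rel s s'" by blast
  then show ?case
  proof cases
    case 1
    then show ?thesis using val_unique[OF v] by simp
  next
    case 2
    then show ?thesis using val_wstep.IH(2) val_wstep.val_wstep by blast
  qed
next
  case (wstep_beta b t)
  from wstep_beta.prems show ?case
  proof (cases rule: rel.cases)
    case (rel_App f' t')
    then obtain b' where "f' = Lam b'" "rel b b'"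
      by (auto elim!: rel_LamE intro: rel.rel_refl)
    then show ?thesis using rel_App rel_inst val_wstep.wstep_beta by blast
  qed (auto intro: val_wstep.wstep_beta rel.rel_refl)
next
  case (wstep_Rec m k g h)
  from wstep_Rec.prems show ?case
  proof (cases rule: rel.cases)
    case (rel_App f' m')
    from rel_App(2) obtain g' h' where "f' = Rec \<cdot> g' \<cdot> h'" "rel g g'" "rel h h'"
      by (auto elim!: rel_appE intro: rel.rel_refl)
    moreover have "rel (rec_unfold g h k) (rec_unfold g' h' k)"
      using calculation by (cases k) (auto intro!: rel.rel_App intro: rel.rel_refl)
    \<comment> \<open>The related argument has the same value, so both recursors unfold at the same
      \<open>k\<close> and the numerals in the two unfoldings coincide.\<close>
    moreover have "val m' k" using rel_App wstep_Rec.IH by blast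
    ultimately show ?thesis using rel_App val_wstep.wstep_Rec by blast
  qed (use wstep_Rec.hyps in \<open>auto intro: val_wstep.wstep_Rec rel.rel_refl\<close>)
next
  case (wstep_app t s u)
  from wstep_app.prems show ?case
  proof (cases rule: rel.cases)
    case (rel_App f' u')
    then consider m where "val t m" | "dead t" | s' where "wstep f' s'" "rel s s'"
      using wstep_app.IH by blast
    then show ?thesis
    proof cases
      case 1
      then show ?thesis using val_dead_app by blast
    next
      case 2
      then show ?thesis using dead_app by blast
    next
      case 3
      then show ?thesis using rel_App val_wstep.wstep_app rel.rel_App by blast
    qed
  qed (use wstep_app.hyps in \<open>auto intro: val_wstep.wstep_app rel.rel_refl\<close>)
qed

lemmas rel_val_transfer = rel_simulation(1)


section \<open>Soundness\<close>

lemma rec_unfold_wstep: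
  "val m k \<Longrightarrow> rec_unfold g h k = t \<Longrightarrow> wstep (Rec \<cdot> g \<cdot> h \<cdot> m) t"
  using wstep_Rec by blast

lemma head_step_wstep: "t \<rhd> t' \<Longrightarrow> wstep t t'"
  by (induction rule: head_step.induct) (auto intro: wstep_beta wstep_app rec_unfold_wstep)

lemma val_head_step: "t \<rhd> t' \<Longrightarrow> val (psubst \<sigma> t) n \<longleftrightarrow> val (psubst \<sigma> t') n"
  using head_step_psubst head_step_wstep val_wstep_iff by blast

lemma psubst_up_app:
  "psubst (case_nat s \<sigma>) (up f \<cdot> Var 0) = psubst \<sigma> f \<cdot> s"
  by (simp add: psubst_up)

lemma rel_fun_upd: "rel s s' \<Longrightarrow> rel (psubst (\<sigma>(i := s)) t) (psubst (\<sigma>(i := s')) t)"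
  by (rule rel_psubst2) (auto intro: rel_refl)

lemma val_fun_upd:
  "val s m \<Longrightarrow> val s' m \<Longrightarrow> val (psubst (\<sigma>(i := s)) t) n \<Longrightarrow> val (psubst (\<sigma>(i := s')) t) n"
  using rel_fun_upd rel_val rel_val_transfer by blast

lemma val_app_cong: "val s m \<Longrightarrow> val s' m \<Longrightarrow> val (t \<cdot> s) n \<Longrightarrow> val (t \<cdot> s') n"
  using rel_App[OF rel_refl] rel_val rel_val_transfer by blast

text \<open>The rule \<open>rec_eq\<close> mentions \<open>m\<close> itself, while the contractum in
  the model mentions the numeral of its value; \<open>rel\<close> bridges the two.\<close>

lemma val_Rec_S:
  assumes "val m k" "val (h \<cdot> m \<cdot> (Rec \<cdot> g \<cdot> h \<cdot> m)) n"
  shows "val (Rec \<cdot> g \<cdot> h \<cdot> S m) n"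
proof -
  have "rel m (numeral_tm k)" using assms(1) by (auto intro: rel_val)
  then have "rel (h \<cdot> m \<cdot> (Rec \<cdot> g \<cdot> h \<cdot> m)) (h \<cdot> numeral_tm k \<cdot> (Rec \<cdot> g \<cdot> h \<cdot> numeral_tm k))"
    by (auto intro!: rel_App intro: rel_refl)
  from rel_val_transfer[OF assms(2) this] have "val (rec_unfold g h (Suc k)) n" by simp
  then show ?thesis using wstep_Rec[of "S m" "Suc k" g h] assms(1) val_wstep by simp
qed

text \<open>Premises are assumed sound under every assignment because substitution, induction and
  the quantifier rules evaluate them under an altered one.\<close>

lemma rga_rule_sound:
  assumes "rga_rule J (\<Gamma>, c)"
    and J: "\<And>\<Delta> d \<sigma>. (\<Delta>, d) \<in> J \<Longrightarrow> (\<And>g. g |\<in>| \<Delta> \<Longrightarrow> val (psubst \<sigma> g) 1) \<Longrightarrow> val (psubst \<sigma> d) 1"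
    and \<Gamma>: "\<And>g. g |\<in>| \<Gamma> \<Longrightarrow> val (psubst \<sigma> g) 1"
  shows "val (psubst \<sigma> c) 1"
proof -
  have IH: "val (psubst \<sigma> d) 1" if "(\<Gamma>, d) \<in> J" for d
    using J[OF that] \<Gamma> by blast
  have IH1: "val (psubst \<sigma> d) 1" if "(finsert a \<Gamma>, d) \<in> J" "val (psubst \<sigma> a) 1" for a d
    using J[OF that(1), of \<sigma>] that(2) \<Gamma> by auto
  from assms(1) show ?thesis
  proof (cases rule: rga_rule.cases)
    case (weak \<Delta> a)
    then show ?thesis using J[of \<Delta> c \<sigma>] \<Gamma> by auto
  next
    case (cut a)
    then show ?thesis using IH IH1 by blast
  next
    case (subst \<Delta> d i s)
    have "val (psubst (\<sigma>(i := psubst \<sigma> s)) d) 1"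
      using subst(3) by (rule J) (metis \<Gamma>[unfolded subst(1)] psubst_subst fimageI)
    then show ?thesis by (simp add: subst(2) psubst_subst)
  next
    case (contra a)
    then show ?thesis using IH[of a] IH[of "Neg a"] val_unique by fastforce
  next
    case (orE a b)
    then show ?thesis using IH[of "a \<squnion> b"] IH1[of a c] IH1[of b c] by auto
  next
    case (eq_subst a b i p)
    obtain k where "val (psubst \<sigma> a) k" "val (psubst \<sigma> b) k"
      using IH[OF eq_subst(2)] by (auto simp: val_Eq_iff)
    then show ?thesis using IH[OF eq_subst(3)] val_fun_upd
      unfolding eq_subst(1) psubst_subst by blast
  next
    case (nat_ind i d a)
    obtain k where k: "val (psubst \<sigma> a) k" using IH[OF nat_ind(4)] by (auto simp: val_Eq_iff)
    have G: "val (psubst (\<sigma>(i := t)) g) 1" if "g |\<in>| \<Gamma>" for g t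
    proof -
      have "psubst (\<sigma>(i := t)) g = psubst \<sigma> g"
        by (rule psubst_cong) (use nat_ind(5) that in auto)
      then show ?thesis using \<Gamma>[OF that] by simp
    qed
    define Q where "Q n \<longleftrightarrow> val (psubst (\<sigma>(i := numeral_tm n)) d) 1" for n
    have "Q 0" using IH[OF nat_ind(2)] by (simp add: Q_def psubst_subst)
    moreover have "Q (Suc n)" if "Q n" for n
    proof -
      have "val (psubst (\<sigma>(i := numeral_tm n)) (subst i (S (Var i)) d)) 1"
        using nat_ind(3) by (rule J) (use G that in \<open>auto simp: Q_def val_Eq_iff\<close>)
      then show ?thesis by (simp add: Q_def psubst_subst)
    qed
    ultimately have "Q n" for n by (induction n) auto
    then have "val (psubst (\<sigma>(i := numeral_tm n)) d) 1" for n by (simp add: Q_def)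
    \<comment> \<open>Induction reaches the numeral of \<open>k\<close>; replacement of equals
      carries the result over to \<open>a\<close>, which has the same value.\<close>
    then have "val (psubst (\<sigma>(i := psubst \<sigma> a)) d) 1"
      using k by (rule_tac val_fun_upd[of "numeral_tm k" k]) auto
    then show ?thesis by (simp add: nat_ind(1) psubst_subst)
  next
    case (conv_expand c')
    then show ?thesis using IH val_head_step by blast
  next
    case (conv_reduce c')
    then show ?thesis using IH val_head_step by blast
  next
    case (conv_neg d c')
    then show ?thesis using IH[of "Neg d"] val_head_step[of d c'] by simp
  next
    case (conv_eq d c')
    then show ?thesis using IH[of "is_N c'"] val_head_step[of d c'] by (auto simp: val_Eq_iff)
  next
    case (rec_eq m h g)
    then show ?thesis using IH[OF rec_eq(2)] IH[OF rec_eq(3)] val_Rec_S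
      by (fastforce simp: val_Eq_iff)
  next
    case (allI f)
    have "val (psubst \<sigma> f \<cdot> numeral_tm n) 1" for n
      unfolding psubst_up_app[symmetric]
      using allI(2) by (rule J) (use \<Gamma> in \<open>auto simp: psubst_up val_Eq_iff\<close>)
    then show ?thesis by (simp add: allI(1) val_All_iff)
  next
    case (allE f a)
    obtain k where k: "val (psubst \<sigma> a) k" using IH[OF allE(3)] by (auto simp: val_Eq_iff)
    have "val (psubst \<sigma> f \<cdot> numeral_tm k) 1" using IH[OF allE(2)] by (simp add: val_All_iff)
    then show ?thesis using val_app_cong[of "numeral_tm k" k] k by (simp add: allE(1))
  next
    case (nallI f a)
    obtain k where k: "val (psubst \<sigma> a) k" using IH[OF nallI(3)] by (auto simp: val_Eq_iff)
    have "val (psubst \<sigma> f \<cdot> psubst \<sigma> a) 0" using IH[OF nallI(2)] by simp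
    then have "val (psubst \<sigma> f \<cdot> numeral_tm k) 0" using val_app_cong[OF k] by simp
    then show ?thesis by (auto simp: nallI(1) val_All_iff)
  next
    case (nallE f)
    \<comment> \<open>A false universal has a numeral counterexample, which becomes the value of the
      new variable.\<close>
    obtain n where n: "val (psubst \<sigma> f \<cdot> numeral_tm n) 0"
      using IH[OF nallE(1)] by (auto simp: val_All_iff)
    have "val (psubst (case_nat (numeral_tm n) \<sigma>) (up c)) 1"
      using nallE(2) by (rule J) (use n \<Gamma> in \<open>auto simp: psubst_up val_Eq_iff\<close>)
    then show ?thesis by (simp add: psubst_up)
  next
    case (neq_sym a b)
    then show ?thesis using IH[OF neq_sym(2)] by (simp add: val_Eq_iff) metis
  next
    case (eqB_I a b)
    then show ?thesis using IH[OF eqB_I(2)] IH[OF eqB_I(3)] by (simp add: val_Eq_iff) metis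
  next
    case (succ_neq_zero a)
    then show ?thesis using IH[OF succ_neq_zero(2)] by (force simp: val_Eq_iff)
  next
    case (succ_neqI a b)
    then show ?thesis using IH[OF succ_neqI(2)] by (force simp: val_Eq_iff)
  qed (use \<Gamma> in \<open>auto simp: val_Eq_iff dest!: IH\<close>)
qed

lemma oga_rule_sound:
  assumes "oga_rule J (\<Gamma>, c)"
    and J: "\<And>\<Delta> d \<sigma>. (\<Delta>, d) \<in> J \<Longrightarrow> (\<And>g. g |\<in>| \<Delta> \<Longrightarrow> val (psubst \<sigma> g) 1) \<Longrightarrow> val (psubst \<sigma> d) 1"
    and \<Gamma>: "\<And>g. g |\<in>| \<Gamma> \<Longrightarrow> val (psubst \<sigma> g) 1"
  shows "val (psubst \<sigma> c) 1"
  using assms(1)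
proof (cases rule: oga_rule.cases)
  case rga
  then show ?thesis using rga_rule_sound J \<Gamma> by blast
next
  case (ATI u)
  let ?b = "is_B (up u \<cdot> Var 0)"
  have "val (All \<cdot> Lam (psubst (lift_sub \<sigma>) ?b)) 1"
    using J[OF ATI(2), of \<sigma>] \<Gamma> by simp
  then have "val (Lam (psubst (lift_sub \<sigma>) ?b) \<cdot> numeral_tm n) 1" for n
    unfolding val_All_iff by force
  then have "val (psubst (case_nat (numeral_tm n) \<sigma>) ?b) 1" for n
    using val_wstep_iff[OF wstep_beta] inst_psubst_lift_sub by metis
  then have "val (psubst \<sigma> u \<cdot> numeral_tm n) 1 \<or> val (psubst \<sigma> u \<cdot> numeral_tm n) 0" for n
    by (simp add: psubst_up)
  \<comment> \<open>Classically, either every numeral instance has value 1 or some instance has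
    value 0, which are the two clauses for the quantifier.\<close>
  then show ?thesis by (simp add: ATI(1) val_All_iff) metis
qed

lemma oga_sound:
  assumes "\<Gamma> \<turnstile> c" "\<And>g. g |\<in>| \<Gamma> \<Longrightarrow> val (psubst \<sigma> g) 1"
  shows "val (psubst \<sigma> c) 1"
proof -
  obtain js where js: "is_proof oga_rule js" "(\<Gamma>, c) \<in> set js"
    using assms(1) by (auto simp: oga_def)
  have "js ! i = (\<Gamma>, c) \<Longrightarrow> (\<And>g. g |\<in>| \<Gamma> \<Longrightarrow> val (psubst \<sigma> g) 1) \<Longrightarrow> val (psubst \<sigma> c) 1"
    if "i < length js" for i \<Gamma> c \<sigma>
    using that
  proof (induction i arbitrary: \<Gamma> c \<sigma> rule: less_induct)
    case (less i)
    have "oga_rule (set (take i js)) (\<Gamma>, c)"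
      using js(1) less.prems unfolding is_proof_def by metis
    then show ?case
    proof (rule oga_rule_sound)
      fix \<Delta> d \<tau>
      assume "(\<Delta>, d) \<in> set (take i js)" and *: "\<And>g. g |\<in>| \<Delta> \<Longrightarrow> val (psubst \<tau> g) 1"
      then obtain j where "j < i" "js ! j = (\<Delta>, d)"
        by (auto simp: in_set_conv_nth)
      then show "val (psubst \<tau> d) 1"
        using less.IH[of j \<Delta> d \<tau>] less.prems(3) * by simp
    qed (use less.prems in blast)
  qed
  then show ?thesis using js(2) assms(2) by (metis in_set_conv_nth)
qed


section \<open>Derived rules\<close>

lemma rga_rule_mono: "rga_rule J j \<Longrightarrow> J \<subseteq> J' \<Longrightarrow> rga_rule J' j"
  by (induction rule: rga_rule.induct) (blast intro: rga_rule.intros)+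

lemma oga_rule_mono: "oga_rule J j \<Longrightarrow> J \<subseteq> J' \<Longrightarrow> oga_rule J' j"
  by (induction rule: oga_rule.induct) (blast intro: oga_rule.intros rga_rule_mono)+

lemma is_proof_append:
  assumes "is_proof oga_rule js" "is_proof oga_rule js'"
  shows "is_proof oga_rule (js @ js')"
  unfolding is_proof_def
proof (intro HOL.allI impI)
  fix i
  assume i: "i < length (js @ js')"
  show "oga_rule (set (take i (js @ js'))) ((js @ js') ! i)"
  proof (cases "i < length js")
    case True
    then show ?thesis using assms(1) by (simp add: is_proof_def nth_append)
  next
    case False
    then have "oga_rule (set (take (i - length js) js')) (js' ! (i - length js))"
      using assms(2) i by (simp add: is_proof_def)
    then show ?thesis using False by (auto simp: nth_append elim: oga_rule_mono)
  qed
qed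

text \<open>Finitely many premises have proofs that can be concatenated; by monotonicity, additional
  earlier entries do no harm.\<close>

lemma oga_rule_derivable:
  assumes "finite K" "oga_rule K (\<Gamma>, c)" "\<And>\<Delta> d. (\<Delta>, d) \<in> K \<Longrightarrow> \<Delta> \<turnstile> d"
  shows "\<Gamma> \<turnstile> c"
proof -
  from assms(1,3) have "\<exists>js. is_proof oga_rule js \<and> K \<subseteq> set js"
  proof (induction K rule: finite_induct)
    case empty
    then show ?case by (intro exI[of _ "[]"]) (simp add: is_proof_def)
  next
    case (insert j K)
    obtain js where "is_proof oga_rule js" "K \<subseteq> set js"
      using insert by blast
    moreover obtain js' where "is_proof oga_rule js'" "j \<in> set js'"
      using insert.prems[of "fst j" "snd j"] by (auto simp: oga_def)
    ultimately show ?case using is_proof_append by (intro exI[of _ "js @ js'"]) auto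
  qed
  then obtain js where js: "is_proof oga_rule js" "K \<subseteq> set js" by blast
  have "is_proof oga_rule (js @ [(\<Gamma>, c)])"
    using js oga_rule_mono[OF assms(2) js(2)]
    by (auto simp: is_proof_def nth_append less_Suc_eq)
  then show ?thesis unfolding oga_def by (intro exI[of _ "js @ [(\<Gamma>, c)]"]) simp
qed

lemma oga_rga:
  "finite K \<Longrightarrow> rga_rule K (\<Gamma>, c) \<Longrightarrow> (\<And>\<Delta> d. (\<Delta>, d) \<in> K \<Longrightarrow> \<Delta> \<turnstile> d) \<Longrightarrow> \<Gamma> \<turnstile> c"
  using oga_rule_derivable oga_rule.rga by blast

lemma oga_ATI: "\<Gamma> \<turnstile> All \<cdot> Lam (is_B (up u \<cdot> Var 0)) \<Longrightarrow> \<Gamma> \<turnstile> is_B (All \<cdot> u)"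
  by (rule oga_rule_derivable[of "{(\<Gamma>, All \<cdot> Lam (is_B (up u \<cdot> Var 0)))}"])
    (auto intro: oga_rule.ATI)

lemma oga_hyp: "finsert c \<Gamma> \<turnstile> c"
  by (rule oga_rga[of "{}"]) (auto intro: rga_rule.hyp)

lemma oga_weak: "\<Gamma> \<turnstile> c \<Longrightarrow> finsert a \<Gamma> \<turnstile> c"
  by (rule oga_rga[of "{(\<Gamma>, c)}"]) (auto intro: rga_rule.weak)

lemma oga_eq0I: "\<Gamma> \<turnstile> Neg a \<Longrightarrow> \<Gamma> \<turnstile> a \<doteq> numeral_tm 0"
  by (rule oga_rga[of "{(\<Gamma>, Neg a)}"]) (auto simp del: numeral_tm_simps intro: rga_rule.eq0I)

lemma oga_notnotI: "\<Gamma> \<turnstile> a \<Longrightarrow> \<Gamma> \<turnstile> Neg (Neg a)"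
  by (rule oga_rga[of "{(\<Gamma>, a)}"]) (auto intro: rga_rule.notnotI)

lemma oga_orI1: "\<Gamma> \<turnstile> a \<Longrightarrow> \<Gamma> \<turnstile> a \<squnion> b"
  by (rule oga_rga[of "{(\<Gamma>, a)}"]) (auto intro: rga_rule.orI1)

lemma oga_orI2: "\<Gamma> \<turnstile> b \<Longrightarrow> \<Gamma> \<turnstile> a \<squnion> b"
  by (rule oga_rga[of "{(\<Gamma>, b)}"]) (auto intro: rga_rule.orI2)

lemma oga_orE: "\<Gamma> \<turnstile> a \<squnion> b \<Longrightarrow> finsert a \<Gamma> \<turnstile> c \<Longrightarrow> finsert b \<Gamma> \<turnstile> c \<Longrightarrow> \<Gamma> \<turnstile> c"
  by (rule oga_rga[of "{(\<Gamma>, a \<squnion> b), (finsert a \<Gamma>, c), (finsert b \<Gamma>, c)}"])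
    (auto intro: rga_rule.orE[of _ a b])

lemma oga_eq_sym: "\<Gamma> \<turnstile> a \<doteq> b \<Longrightarrow> \<Gamma> \<turnstile> b \<doteq> a"
  by (rule oga_rga[of "{(\<Gamma>, a \<doteq> b)}"]) (auto intro: rga_rule.eq_sym)

lemma oga_eq_subst: "\<Gamma> \<turnstile> a \<doteq> b \<Longrightarrow> \<Gamma> \<turnstile> subst i a p \<Longrightarrow> \<Gamma> \<turnstile> subst i b p"
  by (rule oga_rga[of "{(\<Gamma>, a \<doteq> b), (\<Gamma>, subst i a p)}"]) (auto intro: rga_rule.eq_subst[of _ a])

lemma oga_eqB: "\<Gamma> \<turnstile> is_N a \<Longrightarrow> \<Gamma> \<turnstile> is_N b \<Longrightarrow> \<Gamma> \<turnstile> is_B (a \<doteq> b)"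
  by (rule oga_rga[of "{(\<Gamma>, is_N a), (\<Gamma>, is_N b)}"]) (auto intro: rga_rule.eqB_I)

lemma oga_zeroN: "\<Gamma> \<turnstile> is_N Zero"
  by (rule oga_rga[of "{}"]) (auto intro: rga_rule.zeroN)

lemma oga_succN: "\<Gamma> \<turnstile> is_N a \<Longrightarrow> \<Gamma> \<turnstile> is_N (S a)"
  by (rule oga_rga[of "{(\<Gamma>, is_N a)}"]) (auto intro: rga_rule.succN_I)

lemma oga_nat_ind:
  "\<Gamma> \<turnstile> subst i Zero c \<Longrightarrow> finsert (is_N (Var i)) (finsert c \<Gamma>) \<turnstile> subst i (S (Var i)) c
    \<Longrightarrow> \<Gamma> \<turnstile> is_N a \<Longrightarrow> \<forall>g \<in> fset \<Gamma>. i \<notin> fv g \<Longrightarrow> \<Gamma> \<turnstile> subst i a c"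
  by (rule oga_rga[of "{(\<Gamma>, subst i Zero c),
      (finsert (is_N (Var i)) (finsert c \<Gamma>), subst i (S (Var i)) c), (\<Gamma>, is_N a)}"])
    (auto intro!: rga_rule.nat_ind)

lemma oga_conv_expand: "c \<rhd> c' \<Longrightarrow> \<Gamma> \<turnstile> c' \<Longrightarrow> \<Gamma> \<turnstile> c"
  by (rule oga_rga[of "{(\<Gamma>, c')}"]) (auto intro: rga_rule.conv_expand)

lemma oga_conv_eq: "c \<rhd> c' \<Longrightarrow> \<Gamma> \<turnstile> is_N c' \<Longrightarrow> \<Gamma> \<turnstile> c \<doteq> c'"
  by (rule oga_rga[of "{(\<Gamma>, is_N c')}"]) (auto intro: rga_rule.conv_eq)

lemma oga_rec_eq:
  "\<Gamma> \<turnstile> is_N m \<Longrightarrow> \<Gamma> \<turnstile> is_N (h \<cdot> m \<cdot> (Rec \<cdot> g \<cdot> h \<cdot> m))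
    \<Longrightarrow> \<Gamma> \<turnstile> Rec \<cdot> g \<cdot> h \<cdot> S m \<doteq> h \<cdot> m \<cdot> (Rec \<cdot> g \<cdot> h \<cdot> m)"
  by (rule oga_rga[of "{(\<Gamma>, is_N m), (\<Gamma>, is_N (h \<cdot> m \<cdot> (Rec \<cdot> g \<cdot> h \<cdot> m)))}"])
    (auto intro: rga_rule.rec_eq)

lemma oga_allI: "finsert (is_N (Var 0)) (up |`| \<Gamma>) \<turnstile> up f \<cdot> Var 0 \<Longrightarrow> \<Gamma> \<turnstile> All \<cdot> f"
  by (rule oga_rga[of "{(finsert (is_N (Var 0)) (up |`| \<Gamma>), up f \<cdot> Var 0)}"])
    (auto intro: rga_rule.allI)

section \<open>Denotation and Booleanness along head steps\<close>

lemma oga_eq_N: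
  assumes "\<Gamma> \<turnstile> a \<doteq> b"
  shows "\<Gamma> \<turnstile> is_N a"
proof -
  \<comment> \<open>Reflexivity is not free, since \<open>a \<doteq> a\<close> says that
    \<open>a\<close> denotes. It arises by rewriting the left side of \<open>b \<doteq> a\<close>
    with that same equation; freshness of \<open>i\<close> protects the right side.\<close>
  obtain i where "i \<notin> fv a" using fresh_index[of "{a}"] by auto
  then show ?thesis
    using oga_eq_subst[OF oga_eq_sym[OF assms], of i "Var i \<doteq> a"] oga_eq_sym[OF assms]
    by (simp add: subst_fresh)
qed

lemma oga_N_expand: "c \<rhd> c' \<Longrightarrow> \<Gamma> \<turnstile> is_N c' \<Longrightarrow> \<Gamma> \<turnstile> is_N c"
  using oga_conv_eq oga_eq_N by blast

lemma oga_N_expand_steps: "head_step\<^sup>*\<^sup>* c c' \<Longrightarrow> \<Gamma> \<turnstile> is_N c' \<Longrightarrow> \<Gamma> \<turnstile> is_N c"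
  by (induction rule: converse_rtranclp_induct) (auto intro: oga_N_expand)

text \<open>The calculus has no rule expanding a head step below a negation; the refuted case goes
  through an equation, which is available because a refuted term equals \<open>\<zero>\<close>.\<close>

lemma oga_B_expand:
  assumes "c \<rhd> c'" "\<Gamma> \<turnstile> is_B c'"
  shows "\<Gamma> \<turnstile> is_B c"
  using assms(2)
proof (rule oga_orE)
  show "finsert c' \<Gamma> \<turnstile> is_B c"
    by (rule oga_orI1) (rule oga_conv_expand[OF assms(1) oga_hyp])
  let ?\<Delta> = "finsert (Neg c') \<Gamma>"
  have "?\<Delta> \<turnstile> c \<doteq> c'"
    by (rule oga_conv_eq[OF assms(1)]) (rule oga_eq_N[OF oga_eq0I[OF oga_hyp]])
  then have "?\<Delta> \<turnstile> Neg c"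
    using oga_eq_subst[of ?\<Delta> c' c 0 "Neg (Var 0)"] oga_eq_sym oga_hyp by simp
  then show "?\<Delta> \<turnstile> is_B c" by (rule oga_orI2)
qed

lemma oga_B_Neg: "\<Gamma> \<turnstile> is_B a \<Longrightarrow> \<Gamma> \<turnstile> is_B (Neg a)"
  by (erule oga_orE) (blast intro: oga_orI1 oga_orI2 oga_notnotI oga_hyp)+

lemma oga_B_All:
  assumes "finsert (is_N (Var 0)) (up |`| \<Gamma>) \<turnstile> is_B (up u \<cdot> Var 0)"
  shows "\<Gamma> \<turnstile> All \<cdot> Lam (is_B (up u \<cdot> Var 0))"
proof (rule oga_allI)
  let ?b = "is_B (up u \<cdot> Var 0)"
  \<comment> \<open>Shifting every index but 0 and then putting \<open>Var 0\<close> for index 0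
    cancel each other.\<close>
  have "inst 0 (Var 0) (lift_from (Suc 0) (up u)) = up u"
    unfolding inst_eq lift_from_eq psubst_psubst by (rule psubst_cong) simp
  then have "up (Lam ?b) \<cdot> Var 0 \<rhd> ?b"
    using beta[of "lift_from (Suc 0) ?b" "Var 0"] by simp
  then show "finsert (is_N (Var 0)) (up |`| \<Gamma>) \<turnstile> up (Lam ?b) \<cdot> Var 0"
    using assms by (rule oga_conv_expand)
qed


section \<open>Compiled terms\<close>

lemma lams_simps [simp]: "lams 0 t = t" "lams (Suc n) t = Lam (lams n t)"
  by (simp_all add: lams_def)

lemma psubst_apps [simp]: "psubst \<sigma> (apps t us) = apps (psubst \<sigma> t) (map (psubst \<sigma>) us)"
  by (induction us arbitrary: t) simp_all

lemma head_step_apps: "t \<rhd> t' \<Longrightarrow> apps t us \<rhd> apps t' us"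
  by (induction us arbitrary: t t') (auto intro: head_step.app)

text \<open>The innermost binder receives the last argument, hence \<open>rev\<close>. Larger
  indices are lowered because the binders have been consumed.\<close>

definition env :: "tm list \<Rightarrow> nat \<Rightarrow> tm" where
  "env us i = (if i < length us then rev us ! i else Var (i - length us))"

text \<open>Each contraction leaves the remaining binders over an instantiated body, so the
  induction carries an arbitrary environment that grows by one argument per step.\<close>

lemma lams_steps_aux:
  "length us = n \<Longrightarrow> head_step\<^sup>*\<^sup>* (apps (psubst \<sigma> (lams n t)) us)
     (psubst (\<lambda>i. if i < length us then rev us ! i else \<sigma> (i - length us)) t)"
proof (induction us arbitrary: n \<sigma>)
  case Nil
  then show ?case by simp
next
  case (Cons u us)
  then obtain m where m: "n = Suc m" "length us = m" by auto
  have "psubst \<sigma> (lams n t) \<cdot> u \<rhd> psubst (case_nat u \<sigma>) (lams m t)"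
    using beta[of "psubst (lift_sub \<sigma>) (lams m t)" u] by (simp add: m inst_psubst_lift_sub)
  then have "apps (psubst \<sigma> (lams n t)) (u # us) \<rhd> apps (psubst (case_nat u \<sigma>) (lams m t)) us"
    by (simp add: head_step_apps)
  moreover have "(\<lambda>i. if i < length us then rev us ! i else case_nat u \<sigma> (i - length us))
      = (\<lambda>i. if i < length (u # us) then rev (u # us) ! i else \<sigma> (i - length (u # us)))"
    by (rule ext) (auto simp: nth_append less_Suc_eq diff_Suc split: nat.split)
  ultimately show ?case
    using Cons.IH[OF m(2), of "case_nat u \<sigma>"] by (simp only: converse_rtranclp_into_rtranclp)
qed

lemma lams_steps: "length us = n \<Longrightarrow> head_step\<^sup>*\<^sup>* (apps (lams n t) us) (psubst (env us) t)"
  using lams_steps_aux[of us n Var t] by (simp add: env_def[abs_def])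

text \<open>Indices count from the last argument, so a prefix \<open>us\<close> does not disturb
  those of \<open>xs\<close>. The prefix \<open>[y]\<close> is the recursion argument in the
  \<open>PRec\<close> case.\<close>

lemma psubst_env_args: "map (psubst (env (us @ xs))) (args (length xs)) = xs"
  by (rule nth_equalityI) (auto simp: args_def env_def rev_nth nth_append)

lemma psubst_env_args_all [simp]: "length xs = n \<Longrightarrow> map (psubst (env xs)) (args n) = xs"
  using psubst_env_args[of "[]" xs] by auto

lemma fv_lams [simp]: "fv (lams n t) = {i. i + n \<in> fv t}"
  by (induction n) simp_all

lemma fv_apps [simp]: "fv (apps t us) = fv t \<union> (\<Union>u\<in>set us. fv u)"
  by (induction us arbitrary: t) auto

lemma fv_args: "u \<in> set (args n) \<Longrightarrow> i \<in> fv u \<Longrightarrow> i < n"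
  by (auto simp: args_def)

lemma fv_up: "fv (up t) = Suc ` fv t"
proof -
  have "fv (lift_from k t) = (\<lambda>i. if i < k then i else Suc i) ` fv t" for k
  proof (induction t arbitrary: k)
    case (Lam t)
    show ?case
    proof (intro equalityI subsetI)
      fix i
      assume "i \<in> fv (lift_from k (Lam t))"
      then obtain j where "j \<in> fv t" "Suc i = (if j < Suc k then j else Suc j)"
        by (auto simp: Lam.IH)
      then show "i \<in> (\<lambda>i. if i < k then i else Suc i) ` fv (Lam t)"
        by (cases j) (auto split: if_splits)
    qed (auto simp: Lam.IH image_iff split: if_splits intro: bexI[rotated])
  qed (auto split: if_splits)
  from this[of 0] show ?thesis by simp
qed

lemma fv_cmp: "wf_primdef f \<Longrightarrow> fv (cmp f) = {}"
proof (induction f)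
  case (PProj n i)
  then show ?case by (auto simp: args_def rev_nth)
next
  case (PComp n F Gs)
  then have "fv (cmp F) = {}" "\<forall>G\<in>set Gs. fv (cmp G) = {}" by auto
  then show ?case by (auto dest: fv_args)
next
  case (PRec G H)
  then show ?case by (auto simp: Let_def fv_up dest: fv_args)
qed auto

lemma psubst_cmp [simp]: "wf_primdef f \<Longrightarrow> psubst \<sigma> (cmp f) = cmp f"
  by (rule psubst_closed) (rule fv_cmp)

lemma cmp_PProj_steps:
  assumes "i < n" "length us = n"
  shows "head_step\<^sup>*\<^sup>* (apps (cmp (PProj n i)) us) (us ! i)"
proof -
  have "psubst (env us) (args n ! i) = map (psubst (env us)) (args n) ! i"
    using assms(1) by (simp add: args_def)
  then show ?thesis using lams_steps[OF assms(2), of "args n ! i"] assms(2) by simp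
qed

lemma cmp_PComp_steps:
  assumes "wf_primdef (PComp n F Gs)" "length us = n"
  shows "head_step\<^sup>*\<^sup>* (apps (cmp (PComp n F Gs)) us)
    (apps (cmp F) (map (\<lambda>G. apps (cmp G) us) Gs))"
proof -
  have "map (psubst (env us) \<circ> (\<lambda>G. apps (cmp G) (args n))) Gs = map (\<lambda>G. apps (cmp G) us) Gs"
    using assms by auto
  then show ?thesis
    using lams_steps[OF assms(2), of "apps (cmp F) (map (\<lambda>G. apps (cmp G) (args n)) Gs)"] assms(1)
    by (simp del: map_eq_conv)
qed

text \<open>What the second argument of \<open>Rec\<close> in \<open>cmp (PRec G H)\<close> becomes
  once the parameters \<open>xs\<close> have been supplied.\<close>

definition rec_step_tm :: "primdef \<Rightarrow> tm list \<Rightarrow> tm" where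
  "rec_step_tm H xs = Lam (Lam (apps (cmp H \<cdot> Var 1 \<cdot> Var 0) (map (\<lambda>x. up (up x)) xs)))"

lemma cmp_PRec_steps:
  assumes "wf_primdef (PRec G H)" "length xs = arity G"
  shows "head_step\<^sup>*\<^sup>* (apps (cmp (PRec G H)) (y # xs))
    (Rec \<cdot> apps (cmp G) xs \<cdot> rec_step_tm H xs \<cdot> y)"
proof -
  let ?n = "arity G" and ?\<sigma> = "env (y # xs)"
  have a: "map (psubst ?\<sigma>) (args ?n) = xs"
    using psubst_env_args[of "[y]" xs] assms(2) by simp
  have "map (psubst (lift_sub (lift_sub ?\<sigma>)) \<circ> (\<lambda>x. up (up x))) (args ?n)
      = map (\<lambda>x. up (up x)) (map (psubst ?\<sigma>) (args ?n))"
    by (simp add: psubst_lift_sub_up)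
  moreover have "?\<sigma> ?n = y" using assms(2) by (simp add: env_def nth_append)
  moreover have "lift_sub (lift_sub ?\<sigma>) (Suc 0) = Var (Suc 0)" by simp
  ultimately show ?thesis
    using lams_steps[of "y # xs" "Suc ?n" "Rec \<cdot> apps (cmp G) (args ?n)
      \<cdot> Lam (Lam (apps (cmp H \<cdot> Var 1 \<cdot> Var 0) (map (\<lambda>x. up (up x)) (args ?n)))) \<cdot> Var ?n"] assms
    by (simp add: Let_def a rec_step_tm_def)
qed

lemma rec_step_tm_steps:
  assumes "wf_primdef H"
  shows "head_step\<^sup>*\<^sup>* (rec_step_tm H xs \<cdot> m \<cdot> r) (apps (cmp H) (m # r # xs))"
proof -
  have "map (psubst (env [m, r]) \<circ> (\<lambda>x. up (up x))) xs = xs"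
    by (rule map_idI) (simp add: psubst_up env_def)
  moreover have "env [m, r] (Suc 0) = m" "env [m, r] 0 = r" by (simp_all add: env_def)
  ultimately show ?thesis
    using lams_steps[of "[m, r]" "Suc (Suc 0)"
        "apps (cmp H \<cdot> Var 1 \<cdot> Var 0) (map (\<lambda>x. up (up x)) xs)"] assms
    by (simp add: rec_step_tm_def)
qed

section \<open>Values and provable totality of compiled definitions\<close>

lemma val_steps: "head_step\<^sup>*\<^sup>* t t' \<Longrightarrow> val t' n \<Longrightarrow> val t n"
  by (induction rule: converse_rtranclp_induct) (auto intro: val_wstep head_step_wstep)

text \<open>Head reduction passes arguments unevaluated, so the induction has to admit arbitrary
  terms with values and not only numerals.\<close>

lemma val_cmp:
  assumes "wf_primdef f" "length us = arity f" "list_all2 val us ns"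
  shows "val (apps (cmp f) us) (peval f ns)"
  using assms
proof (induction f arbitrary: us ns)
  case (PZero n)
  then show ?case using val_steps[OF lams_steps[of us n Zero]] by simp
next
  case PSucc
  then obtain u k where [simp]: "us = [u]" "ns = [k]" "val u k"
    by (auto simp: length_Suc_conv list_all2_Cons1)
  have "Lam (S (Var 0)) \<cdot> u \<rhd> S u" using beta[of "S (Var 0)" u] by simp
  from val_wstep[OF head_step_wstep[OF this]] show ?case by simp
next
  case (PProj n i)
  then have "val (us ! i) (ns ! i)" by (simp add: list_all2_conv_all_nth)
  then show ?case using val_steps[OF cmp_PProj_steps] PProj.prems by simp
next
  case (PComp n F Gs)
  have "list_all2 val (map (\<lambda>G. apps (cmp G) us) Gs) (map (\<lambda>G. peval G ns) Gs)"
    using PComp.IH(2) PComp.prems by (auto simp: list_all2_conv_all_nth)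
  then have "val (apps (cmp F) (map (\<lambda>G. apps (cmp G) us) Gs)) (peval F (map (\<lambda>G. peval G ns) Gs))"
    using PComp.IH(1) PComp.prems by simp
  then show ?case using val_steps[OF cmp_PComp_steps] PComp.prems by simp
next
  case (PRec G H)
  then obtain y xs k ms where us: "us = y # xs" "ns = k # ms" "val y k" "list_all2 val xs ms"
      "length xs = arity G"
    by (auto simp: length_Suc_conv list_all2_Cons1)
  let ?g = "apps (cmp G) xs" and ?h = "rec_step_tm H xs"
  let ?r = "rec_nat (peval G ms) (\<lambda>m r. peval H (m # r # ms))"
  \<comment> \<open>Claimed for the unfolding, so that it applies to any recursion argument of value
    \<open>j\<close>, in particular to \<open>y\<close>.\<close>
  have "val (rec_unfold ?g ?h j) (?r j)" for j
  proof (induction j)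
    case 0
    then show ?case using PRec.IH(1) PRec.prems us by simp
  next
    case (Suc j)
    then have "val (Rec \<cdot> ?g \<cdot> ?h \<cdot> numeral_tm j) (?r j)"
      using val_wstep wstep_Rec val_numeral by blast
    then have "val (apps (cmp H) (numeral_tm j # (Rec \<cdot> ?g \<cdot> ?h \<cdot> numeral_tm j) # xs))
        (peval H (j # ?r j # ms))"
      using PRec.IH(2)[of "numeral_tm j # (Rec \<cdot> ?g \<cdot> ?h \<cdot> numeral_tm j) # xs" "j # ?r j # ms"]
        PRec.prems us by simp
    then show ?case using val_steps[OF rec_step_tm_steps] PRec.prems by simp
  qed
  then have "val (Rec \<cdot> ?g \<cdot> ?h \<cdot> y) (?r k)"
    using val_wstep wstep_Rec us(3) by blast
  then show ?case using val_steps[OF cmp_PRec_steps] PRec.prems us by simp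
qed

text \<open>The provable counterpart of \<open>val_cmp\<close>. The context is kept general because
  the recursion case uses the hypothesis for \<open>H\<close> beneath the assumptions of the
  induction rule.\<close>

lemma cmp_total:
  assumes "wf_primdef f" "length us = arity f" "\<And>u. u \<in> set us \<Longrightarrow> \<Gamma> \<turnstile> is_N u"
  shows "\<Gamma> \<turnstile> is_N (apps (cmp f) us)"
  using assms
proof (induction f arbitrary: us \<Gamma>)
  case (PZero n)
  then show ?case using oga_N_expand_steps[OF lams_steps[of us n Zero]] oga_zeroN by simp
next
  case PSucc
  then obtain u where "us = [u]" "\<Gamma> \<turnstile> is_N u"
    by (auto simp: length_Suc_conv)
  moreover have "Lam (S (Var 0)) \<cdot> u \<rhd> S u" using beta[of "S (Var 0)" u] by simp
  ultimately show ?case using oga_N_expand oga_succN by simp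
next
  case (PProj n i)
  then show ?case using oga_N_expand_steps[OF cmp_PProj_steps] by simp
next
  case (PComp n F Gs)
  have "\<Gamma> \<turnstile> is_N (apps (cmp F) (map (\<lambda>G. apps (cmp G) us) Gs))"
  proof (rule PComp.IH(1))
    fix u
    assume "u \<in> set (map (\<lambda>G. apps (cmp G) us) Gs)"
    then obtain G where "G \<in> set Gs" "u = apps (cmp G) us" by auto
    then show "\<Gamma> \<turnstile> is_N u" using PComp.IH(2)[of G us \<Gamma>] PComp.prems by simp
  qed (use PComp.prems in auto)
  then show ?case using oga_N_expand_steps[OF cmp_PComp_steps] PComp.prems by simp
next
  case (PRec G H)
  then obtain y xs where us: "us = y # xs" "length xs = arity G"
    by (auto simp: length_Suc_conv)
  let ?g = "apps (cmp G) xs" and ?h = "rec_step_tm H xs"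
  \<comment> \<open>Freshness for the context is the side condition of induction; freshness for
    \<open>?g\<close> and \<open>?h\<close> confines the substitution to the recursion
    argument.\<close>
  obtain i where i: "\<forall>t \<in> fset \<Gamma> \<union> {?g, ?h}. i \<notin> fv t"
    using fresh_index[of "fset \<Gamma> \<union> {?g, ?h}"] by auto
  let ?c = "is_N (Rec \<cdot> ?g \<cdot> ?h \<cdot> Var i)"
  have sub: "subst i a ?c = is_N (Rec \<cdot> ?g \<cdot> ?h \<cdot> a)" for a
    using i by (simp add: subst_fresh)
  have "\<Gamma> \<turnstile> subst i y ?c"
  proof (rule oga_nat_ind)
    have "\<Gamma> \<turnstile> is_N ?g" using PRec.IH(1) PRec.prems us by simp
    then show "\<Gamma> \<turnstile> subst i Zero ?c" unfolding sub by (rule oga_N_expand[OF rec_zero])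
    let ?\<Delta> = "finsert (is_N (Var i)) (finsert ?c \<Gamma>)"
    have v: "?\<Delta> \<turnstile> is_N (Var i)" by (rule oga_hyp)
    have "?\<Delta> \<turnstile> ?c" by (rule oga_weak[OF oga_hyp])
    with v have "?\<Delta> \<turnstile> is_N (apps (cmp H) (Var i # (Rec \<cdot> ?g \<cdot> ?h \<cdot> Var i) # xs))"
      using PRec.IH(2)[of "Var i # (Rec \<cdot> ?g \<cdot> ?h \<cdot> Var i) # xs" ?\<Delta>] PRec.prems us
      by (auto intro: oga_weak)
    then have "?\<Delta> \<turnstile> is_N (?h \<cdot> Var i \<cdot> (Rec \<cdot> ?g \<cdot> ?h \<cdot> Var i))"
      using oga_N_expand_steps[OF rec_step_tm_steps] PRec.prems by simp
    \<comment> \<open>The rule \<open>rec_eq\<close> asks that its right side denote; the resulting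
      equation shows that the recursor at the successor denotes too.\<close>
    then show "?\<Delta> \<turnstile> subst i (S (Var i)) ?c"
      unfolding sub by (rule oga_eq_N[OF oga_rec_eq[OF v]])
  qed (use i PRec.prems us in auto)
  then have "\<Gamma> \<turnstile> is_N (Rec \<cdot> ?g \<cdot> ?h \<cdot> y)" by (simp only: sub)
  then show ?case using oga_N_expand_steps[OF cmp_PRec_steps] PRec.prems us by simp
qed


section \<open>Search sentences\<close>

definition no_hit :: "primdef \<Rightarrow> tm \<Rightarrow> tm" where
  "no_hit f a = Lam (cmp f \<cdot> up a \<cdot> Var 0 \<doteq> Zero)"

lemma rrep_head_step:
  assumes "wf_primdef f"
  shows "rrep f \<cdot> a \<rhd> Neg (All \<cdot> no_hit f a)"
  using beta[of "Neg (All \<cdot> Lam (cmp f \<cdot> Var 1 \<cdot> Var 0 \<doteq> Zero))" a] assms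
  by (simp add: rrep_def no_hit_def inst_eq)

lemma no_hit_head_step:
  assumes "wf_primdef f"
  shows "no_hit f a \<cdot> b \<rhd> (cmp f \<cdot> a \<cdot> b \<doteq> Zero)"
  using beta[of "cmp f \<cdot> up a \<cdot> Var 0 \<doteq> Zero" b] assms
  by (simp add: no_hit_def inst_eq psubst_up)

lemma up_no_hit: "wf_primdef f \<Longrightarrow> up (no_hit f a) = no_hit f (up a)"
  by (simp add: no_hit_def lift_from_eq psubst_psubst)

lemma fv_rrep: "wf_primdef f \<Longrightarrow> fv (rrep f) = {}"
  by (auto simp: rrep_def fv_cmp)

text \<open>Serves both as the premise of the outer ATI and as the certificate of the universal. The
  inner ATI makes each single search Boolean, because its instances are equations between denoting
  terms.\<close>

lemma oga_rrep_B:
  assumes f: "step_function f"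
  shows "{||} \<turnstile> All \<cdot> Lam (is_B (up (rrep f) \<cdot> Var 0))"
proof (rule oga_B_All)
  have wf: "wf_primdef f" "arity f = 2" using f by (simp_all add: step_function_def)
  have "up (rrep f) = rrep f" using fv_rrep[OF wf(1)] by (simp add: lift_from_eq psubst_closed)
  moreover
  \<comment> \<open>\<open>Var 1\<close> is the input of the search, shifted by the inner
    quantifier, and \<open>Var 0\<close> is the step.\<close>
  let ?\<Delta> = "{|is_N (Var 0), is_N (Var 1)|}"
  have "?\<Delta> \<turnstile> is_N (Var 0)" by (rule oga_hyp)
  moreover have "?\<Delta> \<turnstile> is_N (Var 1)" by (rule oga_weak[OF oga_hyp])
  ultimately have "?\<Delta> \<turnstile> is_N (cmp f \<cdot> Var 1 \<cdot> Var 0)"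
    using cmp_total[of f "[Var 1, Var 0]" ?\<Delta>] wf by auto
  then have "?\<Delta> \<turnstile> is_B (up (no_hit f (Var 0)) \<cdot> Var 0)"
    using oga_B_expand[OF no_hit_head_step[OF wf(1)]] oga_eqB oga_zeroN
    by (simp add: up_no_hit wf(1))
  then have "{|is_N (Var 0)|} \<turnstile> is_B (All \<cdot> no_hit f (Var 0))"
    by (intro oga_ATI oga_B_All) simp
  then have "{|is_N (Var 0)|} \<turnstile> is_B (rrep f \<cdot> Var 0)"
    by (intro oga_B_expand[OF rrep_head_step[OF wf(1)]] oga_B_Neg)
  then show "finsert (is_N (Var 0)) (up |`| {||}) \<turnstile> is_B (up (rrep f) \<cdot> Var 0)"
    using \<open>up (rrep f) = rrep f\<close> by simp
qed

text \<open>A step at which the search hits is a counterexample to the inner universal, which makes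
  its negation true; the infinitary clause then collects all inputs.\<close>

lemma val_rrep:
  assumes f: "step_function f" and "\<forall>n. hits f n"
  shows "val (All \<cdot> rrep f) 1"
proof -
  have wf: "wf_primdef f" "arity f = 2" using f by (simp_all add: step_function_def)
  have "val (rrep f \<cdot> numeral_tm n) 1" for n
  proof -
    obtain k where k: "peval f [n, k] \<noteq> 0"
      using assms(2) by (auto simp: hits_def hits_at_step_def)
    have "val (cmp f \<cdot> numeral_tm n \<cdot> numeral_tm k) (peval f [n, k])"
      using val_cmp[of f "[numeral_tm n, numeral_tm k]" "[n, k]"] wf by simp
    then have "val (cmp f \<cdot> numeral_tm n \<cdot> numeral_tm k \<doteq> Zero) 0"
      using k by (auto simp: val_Eq_iff)
    then have "val (no_hit f (numeral_tm n) \<cdot> numeral_tm k) 0"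
      using val_wstep head_step_wstep no_hit_head_step wf(1) by blast
    then have "val (Neg (All \<cdot> no_hit f (numeral_tm n))) 1"
      by (auto simp: val_All_iff)
    then show ?thesis
      using val_wstep head_step_wstep rrep_head_step wf(1) by blast
  qed
  then show ?thesis by (simp add: val_All_iff)
qed

theorem theorem6p10:
  fixes f :: primdef and G :: tm
  assumes "step_function f"
    and "\<forall>n. hits f n"
    and "G = All \<cdot> rrep f"
    and "\<not> ({||} \<turnstile> G)"
  shows "({||} \<turnstile> is_B G)
       \<and> \<not> ({||} \<turnstile> Neg G)
       \<and> \<not> ({||} \<turnstile> G)
       \<and> genuine_fiction G
       \<and> (\<nexists>c. ({|G|} \<turnstile> c) \<and> ({|G|} \<turnstile> Neg c))"
proof -
  have true: "val G 1" using val_rrep assms(1-3) by simp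
  have B: "{||} \<turnstile> is_B G"
    unfolding assms(3) by (intro oga_ATI oga_rrep_B assms(1))
  have no_contradiction: "\<not> (({|G|} \<turnstile> c) \<and> ({|G|} \<turnstile> Neg c))" for c
  proof
    assume "({|G|} \<turnstile> c) \<and> ({|G|} \<turnstile> Neg c)"
    \<comment> \<open>The assignment \<open>Var\<close> is the identity, so soundness applies to
      \<open>c\<close> itself even when it is open.\<close>
    then have "val c 1" "val (Neg c) 1"
      using oga_sound[of "{|G|}" c Var] oga_sound[of "{|G|}" "Neg c" Var] true by auto
    then show False using val_unique[of c 1 0] by simp
  qed
  \<comment> \<open>A refutation of \<open>G\<close> would, after weakening by \<open>G\<close>,
    contradict the hypothesis \<open>G\<close>.\<close>
  have not_refuted: "\<not> ({||} \<turnstile> Neg G)"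
    using no_contradiction[of G] oga_hyp oga_weak by blast
  have "certified G"
    unfolding certified_def assms(3) using oga_rrep_B[OF assms(1)] by blast
  then have "genuine_fiction G"
    using assms(1,3,4) not_refuted evaluates.univ fv_rrep[of f]
    by (auto simp: genuine_fiction_def step_function_def)
  then show ?thesis using B not_refuted assms(4) no_contradiction by blast
qed

end
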